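(* For every integer $t\geqslant 1$ there exist infinitely many graphs $G$ with $\text{tree-}\alpha(G)=2t$ such that, for every $\lambda\geqslant 1$, $$\tau_{G,\lambda}\geqslant (\lambda n)^{c\,t\ln(n)},$$ where $n=|V(G)|$ and $c>0$ is a constant.
   Context: A tree decomposition of $G$ is a pair $(T,\{X_s\}_{s\in V(T)})$ with $T$ a tree and bags $X_s\subseteq V(G)$ such that every vertex lies in some bag, every edge has both endpoints in some bag, and for each vertex the nodes whose bags contain it induce a connected subtree. Its independence number is $\max_s \alpha(G[X_s])$, and $\text{tree-}\alpha(G)$ is the minimum independence number over all tree decompositions of $G$. For a graph $G$ on $n$ vertices and $\lambda>0$: $\mathcal{I}(G)$ is the set of independent sets, $Z_G(\lambda)=\sum_{J\in\mathcal{I}(G)}\lambda^{|J|}$, $\pi_{G,\lambda}(I)=\lambda^{|I|}/Z_G(\lambda)$. The Glauber dynamics picks a uniform random vertex $v$; if $v\in I$ it is removed with probability $\frac1{\lambda+1}$; if $v\notin I$ and $I\cup\{v\}$ is independent it is added with probability $\frac{\lambda}{\lambda+1}$; otherwise nothing changes. The mixing time $\tau_{G,\lambda}$ is the least $t$ such that for every starting independent set $I$, the total variation distance between the distribution after $t$ steps and $\pi_{G,\lambda}$ is at most $1/4$. *)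

theory Defs
  imports "HOL-Probability.Probability" "Graph_Theory.Graph_Theory"
begin

text \<open>
  A finite simple graph is a symmetric, loop-free digraph without parallel arcs on a finite
  vertex set (the locale \<^locale>\<open>graph\<close>); an undirected edge is a pair of opposite arcs.
\<close>

definition independent_sets :: "('a, 'b) pre_digraph \<Rightarrow> 'a set set" where
  "independent_sets G = {I. I \<subseteq> verts G \<and> (\<forall>u\<in>I. \<forall>v\<in>I. \<not> u \<rightarrow>\<^bsub>G\<^esub> v)}"

definition independence_number :: "('a, 'b) pre_digraph \<Rightarrow> nat" where
  "independence_number G = Max (card ` independent_sets G)"

text \<open>
  The predicate \<^const>\<open>Digraph_Component.tree\<close> is of no use for symmetric digraphs: two opposite
  arcs already form a directed cycle. In a symmetric simple digraph the cycles
  of the underlying undirected graph are the directed cycles of length at least 3.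
  Connectedness includes having at least one vertex.
\<close>

definition is_tree :: "('a, 'b) pre_digraph \<Rightarrow> bool" where
  "is_tree T \<longleftrightarrow> graph T \<and> Digraph_Component.connected T \<and>
     \<not> (\<exists>p. pre_digraph.cycle T p \<and> 3 \<le> length p)"

definition tree_decomposition ::
  "('a, 'b) pre_digraph \<Rightarrow> ('s, 'e) pre_digraph \<Rightarrow> ('s \<Rightarrow> 'a set) \<Rightarrow> bool" where
  "tree_decomposition G T X \<longleftrightarrow> is_tree T \<and>
     (\<forall>s\<in>verts T. X s \<subseteq> verts G) \<and>
     (\<forall>v\<in>verts G. \<exists>s\<in>verts T. v \<in> X s) \<and>
     (\<forall>u v. u \<rightarrow>\<^bsub>G\<^esub> v \<longrightarrow> (\<exists>s\<in>verts T. u \<in> X s \<and> v \<in> X s)) \<and>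
     (\<forall>v\<in>verts G. Digraph_Component.connected (T \<restriction> {s \<in> verts T. v \<in> X s}))"

definition decomposition_independence_number ::
  "('a, 'b) pre_digraph \<Rightarrow> ('s, 'e) pre_digraph \<Rightarrow> ('s \<Rightarrow> 'a set) \<Rightarrow> nat" where
  "decomposition_independence_number G T X =
     Max ((\<lambda>s. independence_number (G \<restriction> X s)) ` verts T)"

text \<open>Trees are finite, so node type \<^typ>\<open>nat\<close> covers all of them up to isomorphism.\<close>

definition tree_alpha :: "('a, 'b) pre_digraph \<Rightarrow> nat" where
  "tree_alpha G = (LEAST k. \<exists>(T :: (nat, nat \<times> nat) pre_digraph) X.
     tree_decomposition G T X \<and> decomposition_independence_number G T X = k)"

definition partition_function :: "('a, 'b) pre_digraph \<Rightarrow> real \<Rightarrow> real" where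
  "partition_function G lam = (\<Sum>J\<in>independent_sets G. lam ^ card J)"

definition hardcore_pmf :: "('a, 'b) pre_digraph \<Rightarrow> real \<Rightarrow> 'a set pmf" where
  "hardcore_pmf G lam = embed_pmf (\<lambda>I. if I \<in> independent_sets G
     then lam ^ card I / partition_function G lam else 0)"

lemma finite_independent_sets: "finite (verts G) \<Longrightarrow> finite (independent_sets G)"
  by (rule finite_subset[of _ "Pow (verts G)"]) (auto simp: independent_sets_def)

lemma partition_function_pos:
  assumes "finite (verts G)" "0 < lam"
  shows "0 < partition_function G lam"
  unfolding partition_function_def
proof (rule sum_pos)
  show "independent_sets G \<noteq> {}"
    by (auto simp: independent_sets_def)
qed (use assms finite_independent_sets in auto)

lemma pmf_hardcore:
  assumes "finite (verts G)" "0 < lam"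
  shows "pmf (hardcore_pmf G lam) I =
    (if I \<in> independent_sets G then lam ^ card I / partition_function G lam else 0)"
  unfolding hardcore_pmf_def
proof (rule pmf_embed_pmf)
  let ?f = "\<lambda>I. if I \<in> independent_sets G
    then lam ^ card I / partition_function G lam else 0"
  have pos: "0 < partition_function G lam"
    using assms by (rule partition_function_pos)
  then show nn: "0 \<le> ?f I" for I
    using assms by auto
  have fin: "finite (independent_sets G)"
    using assms by (simp add: finite_independent_sets)
  have "(\<integral>\<^sup>+I. ennreal (?f I) \<partial>count_space UNIV) = (\<Sum>I\<in>independent_sets G. ennreal (?f I))"
    by (rule nn_integral_count_space'[OF fin]) auto
  also have "\<dots> = ennreal (\<Sum>I\<in>independent_sets G. ?f I)"
    by (rule sum_ennreal) (rule nn)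
  also have "(\<Sum>I\<in>independent_sets G. ?f I) = 1"
    using pos by (simp add: partition_function_def flip: sum_divide_distrib)
  finally show "(\<integral>\<^sup>+I. ennreal (?f I) \<partial>count_space UNIV) = 1"
    by simp
qed

text \<open>Meaningful for graphs with at least one vertex, as a uniform vertex is drawn.\<close>

definition glauber_step :: "('a, 'b) pre_digraph \<Rightarrow> real \<Rightarrow> 'a set \<Rightarrow> 'a set pmf" where
  "glauber_step G lam I =
     bind_pmf (pmf_of_set (verts G)) (\<lambda>v.
       if v \<in> I then
         map_pmf (\<lambda>b. if b then I - {v} else I) (bernoulli_pmf (1 / (lam + 1)))
       else if insert v I \<in> independent_sets G then
         map_pmf (\<lambda>b. if b then insert v I else I) (bernoulli_pmf (lam / (lam + 1)))
       else return_pmf I)"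

definition glauber_dist :: "('a, 'b) pre_digraph \<Rightarrow> real \<Rightarrow> 'a set \<Rightarrow> nat \<Rightarrow> 'a set pmf" where
  "glauber_dist G lam I k = ((\<lambda>p. bind_pmf p (glauber_step G lam)) ^^ k) (return_pmf I)"

definition tv_dist :: "'a pmf \<Rightarrow> 'a pmf \<Rightarrow> real" where
  "tv_dist p q = (SUP A. \<bar>measure_pmf.prob p A - measure_pmf.prob q A\<bar>)"

definition mixing_time :: "('a, 'b) pre_digraph \<Rightarrow> real \<Rightarrow> nat" where
  "mixing_time G lam = (LEAST k. \<forall>I\<in>independent_sets G.
     tv_dist (glauber_dist G lam I k) (hardcore_pmf G lam) \<le> 1 / 4)"

end

(*
Idea. Take the complete binary tree of depth h and replace every node by two sides, each consisting
of t disjoint cliques of size m; join opposite sides completely at equal and at adjacent nodes. An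
independent set then occupies disjoint node sets on the two sides, and no edge of the tree runs
between them, so the unoccupied nodes form a separator. The number of leaves occupied on one side
changes by at most one in each step, so the dynamics has to pass through the states where this number
is (2^(h+1) - 1) / 3. Since the binary expansion of this number alternates, every such state has at
least h/18 unoccupied nodes, each of which costs a factor of about (m lam)^t. The parent map of
the tree gives bags of independence number 2t, and the vertex sets above an edge of the tree contain
an induced complete bipartite graph with sides of size 2t. In any tree decomposition some vertex has
its closed neighbourhood inside one bag, so one bag contains a side of that bipartite graph.
*)

theory Submission
  imports Defs
begin

section \<open>Tree decompositions\<close>

text \<open>The leaf number \<open>(2^(h+1) - 1) / 3\<close> is chosen because, divided by
  \<open>2^k\<close>, it stays at distance at least 1/6 from every integer for all k from 1 to h.
  For a set with few boundary edges the number of its nodes almost doubles from level to level,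
  which contradicts this distance unless boundary edges appear at a rate of 1/6 per level. What has
  to be beaten is entropy. With M = 2^(h+1), an unoccupied node can be placed in about M ways and
  leaves the sides of its two children free, so its cost must exceed 4 M. The cliques supply this:
  they turn the fugacity lam into m lam without changing any independence number, and m = M^4
  suffices for all lam >= 1 at once. The graph then has at most M^6 vertices, so h is of order ln n,
  and order h unoccupied nodes, each costing at least (M lam)^t after the entropy is paid, yield an
  exponent of order t ln n.\<close>

definition cycle_free :: "('s \<times> 's) set \<Rightarrow> 's set \<Rightarrow> bool" where
  "cycle_free R V \<longleftrightarrow> \<not> (\<exists>p. 3 \<le> length p \<and> distinct p \<and> set p \<subseteq> V \<and>
     successively (\<lambda>a b. (a, b) \<in> R) p \<and> (last p, hd p) \<in> R)"

text \<open>Both notions take a fixed relation and a varying node set, so that deleting a leaf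
  shrinks the set and leaves the relation alone.\<close>

definition connected_on :: "('s \<times> 's) set \<Rightarrow> 's set \<Rightarrow> bool" where
  "connected_on R C \<longleftrightarrow> C \<noteq> {} \<and> (\<forall>x\<in>C. \<forall>y\<in>C. (x, y) \<in> (R \<inter> C \<times> C)\<^sup>*)"

lemma cycle_free_subset: "cycle_free R V \<Longrightarrow> U \<subseteq> V \<Longrightarrow> cycle_free R U"
  unfolding cycle_free_def by blast

text \<open>All neighbours of the first node of a longest path lie on the path, as it could be
  extended otherwise. A neighbour beyond the second node would close an initial segment into a
  cycle.\<close>

lemma cycle_free_imp_leaf:
  assumes "finite V" "V \<noteq> {}" "sym R" "irrefl R" "cycle_free R V"
  obtains s where "s \<in> V" "\<And>a b. a \<in> V \<Longrightarrow> b \<in> V \<Longrightarrow> (s, a) \<in> R \<Longrightarrow> (s, b) \<in> R \<Longrightarrow> a = b"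
proof -
  define P where "P p \<longleftrightarrow> p \<noteq> [] \<and> distinct p \<and> set p \<subseteq> V \<and> successively (\<lambda>a b. (a, b) \<in> R) p" for p
  obtain v where "v \<in> V" using assms by auto
  then have "P [v]" by (simp add: P_def)
  moreover have "\<forall>p. P p \<longrightarrow> length p < Suc (card V)"
    using assms(1) unfolding P_def by (metis card_mono distinct_card less_Suc_eq_le)
  ultimately obtain p where p: "P p" and max: "\<And>q. P q \<Longrightarrow> length q \<le> length p"
    using ex_has_greatest_nat[of P "[v]" length "Suc (card V)"] by blast
  then obtain s ps where sp: "p = s # ps" unfolding P_def by (cases p) auto
  have s: "s \<in> V" using p sp by (simp add: P_def)
  have nb: "c \<in> set ps" if "c \<in> V" "(s, c) \<in> R" for c
  proof (rule ccontr)
    assume "c \<notin> set ps"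
    moreover have "c \<noteq> s" using that assms(4) by (auto simp: irrefl_def)
    moreover have "(c, s) \<in> R" using that assms(3) by (auto dest: symD)
    ultimately have "P (c # p)" using p that by (auto simp: P_def sp)
    then show False using max by fastforce
  qed
  have hd: "c = hd ps" if c: "c \<in> V" "(s, c) \<in> R" for c
  proof (rule ccontr)
    assume ne: "c \<noteq> hd ps"
    obtain us ws where ps: "ps = us @ c # ws" using nb[OF c] by (meson split_list)
    then have us: "us \<noteq> []" using ne by auto
    have "(c, s) \<in> R" using c assms(3) by (auto dest: symD)
    moreover have "successively (\<lambda>a b. (a, b) \<in> R) ((s # us @ [c]) @ ws)"
      using p by (simp add: P_def sp ps)
    then have "successively (\<lambda>a b. (a, b) \<in> R) (s # us @ [c])"
      by (subst (asm) successively_append_iff) blast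
    moreover have "3 \<le> length (s # us @ [c])" using us by (cases us) auto
    moreover have "distinct (s # us @ [c])" "set (s # us @ [c]) \<subseteq> V"
      using p by (auto simp: P_def sp ps)
    moreover have "last (s # us @ [c]) = c" "hd (s # us @ [c]) = s" by auto
    ultimately show False using assms(5) unfolding cycle_free_def by (metis (no_types))
  qed
  show thesis using that[OF s] hd by metis
qed

text \<open>A walk that enters a leaf can only leave it through the node it came from, so the
  excursion can be cut out.\<close>

lemma connected_on_remove_leaf:
  assumes "connected_on R C" "s \<in> C" "C \<noteq> {s}" "sym R" "irrefl R"
    and leaf: "\<And>a b. a \<in> C \<Longrightarrow> b \<in> C \<Longrightarrow> (s, a) \<in> R \<Longrightarrow> (s, b) \<in> R \<Longrightarrow> a = b"
  shows "connected_on R (C - {s})"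
  unfolding connected_on_def
proof (intro conjI ballI)
  show "C - {s} \<noteq> {}" using assms by auto
  fix x y assume x: "x \<in> C - {s}" and y: "y \<in> C - {s}"
  have "(x, y) \<in> (R \<inter> C \<times> C)\<^sup>*" using x y assms by (auto simp: connected_on_def)
  \<comment> \<open>While the walk stands at \<open>s\<close>, the invariant records a neighbour of
    \<open>s\<close> reached without \<open>s\<close>; by the leaf property the next step leads to
    that same neighbour.\<close>
  then have "(y \<noteq> s \<longrightarrow> (x, y) \<in> (R \<inter> (C - {s}) \<times> (C - {s}))\<^sup>*) \<and>
    (y = s \<longrightarrow> (\<exists>z\<in>C. (s, z) \<in> R \<and> (x, z) \<in> (R \<inter> (C - {s}) \<times> (C - {s}))\<^sup>*))"
  proof induction
    case base
    then show ?case using x by auto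
  next
    case (step y z)
    have yz: "(y, z) \<in> R" "(z, y) \<in> R" "y \<in> C" "z \<in> C" "y \<noteq> z"
      using step assms(4,5) by (auto dest: symD simp: irrefl_def)
    show ?case
    proof (cases "y = s")
      case True
      then obtain w where "w \<in> C" "(s, w) \<in> R" "(x, w) \<in> (R \<inter> (C - {s}) \<times> (C - {s}))\<^sup>*"
        using step by auto
      moreover from this have "w = z" using leaf yz True by blast
      ultimately show ?thesis using yz True by auto
    next
      case False
      then have *: "(x, y) \<in> (R \<inter> (C - {s}) \<times> (C - {s}))\<^sup>*" using step by auto
      show ?thesis
      proof (cases "z = s")
        case True
        then show ?thesis using * yz by auto
      next
        case zs: False
        then have "(y, z) \<in> R \<inter> (C - {s}) \<times> (C - {s})" using yz False by auto
        then show ?thesis using * zs by (auto intro: rtrancl_into_rtrancl)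
      qed
    qed
  qed
  then show "(x, y) \<in> (R \<inter> (C - {s}) \<times> (C - {s}))\<^sup>*" using y by auto
qed

lemma connected_on_neighbour:
  assumes "connected_on R C" "s \<in> C" "C \<noteq> {s}"
  obtains a where "a \<in> C" "(s, a) \<in> R"
proof -
  obtain y where "y \<in> C" "y \<noteq> s" using assms by auto
  then have "(s, y) \<in> (R \<inter> C \<times> C)\<^sup>*" using assms by (auto simp: connected_on_def)
  then obtain a where "(s, a) \<in> R \<inter> C \<times> C"
    using \<open>y \<noteq> s\<close> by (metis rtranclD tranclD)
  then show thesis using that by blast
qed

text \<open>Leaves are pruned until one carries a vertex of \<open>W\<close> that occurs in no other
  bag; all pairs containing this vertex must then be covered by that bag. As long as there is no
  such vertex, every member of the leaf bag also occurs in the bag next to it, so deleting the leaf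
  loses no covered pair. The vertex found is a simplicial vertex of the chordal graph obtained by
  completing the bags.\<close>

lemma closed_neighbourhood_in_bag:
  assumes "finite V" "sym R" "irrefl R" "cycle_free R V" "W \<noteq> {}"
    and "\<And>v. v \<in> W \<Longrightarrow> connected_on R {s \<in> V. v \<in> X s}"
    and "\<And>u v. u \<in> W \<Longrightarrow> v \<in> W \<Longrightarrow> N u v \<Longrightarrow> \<exists>s\<in>V. u \<in> X s \<and> v \<in> X s"
  shows "\<exists>v\<in>W. \<exists>s\<in>V. v \<in> X s \<and> (\<forall>u\<in>W. N v u \<longrightarrow> u \<in> X s)"
  using assms(1,4,6,7)
proof (induction "card V" arbitrary: V rule: less_induct)
  case less
  have "V \<noteq> {}" using less.prems(3) assms(5) by (auto simp: connected_on_def)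
  then obtain s where s: "s \<in> V"
    "\<And>a b. a \<in> V \<Longrightarrow> b \<in> V \<Longrightarrow> (s, a) \<in> R \<Longrightarrow> (s, b) \<in> R \<Longrightarrow> a = b"
    using cycle_free_imp_leaf[OF less.prems(1) _ assms(2,3) less.prems(2)] by blast
  show ?case
  proof (cases "\<exists>v\<in>W. {r \<in> V. v \<in> X r} = {s}")
    case True
    then obtain v where v: "v \<in> W" "{r \<in> V. v \<in> X r} = {s}" by auto
    then have only: "r = s" if "r \<in> V" "v \<in> X r" for r
      using that by auto
    have "u \<in> X s" if "u \<in> W" "N v u" for u
      using less.prems(4)[OF v(1) that] only by auto
    then show ?thesis using v s(1) by auto
  next
    case False
    have rem: "{r \<in> V - {s}. v \<in> X r} = {r \<in> V. v \<in> X r} - {s}" for v by auto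
    have con: "connected_on R {r \<in> V - {s}. v \<in> X r}" if "v \<in> W" for v
    proof (cases "v \<in> X s")
      case True
      show ?thesis unfolding rem
        by (rule connected_on_remove_leaf) (use True that less.prems(3) False assms(2,3) s in auto)
    next
      case vs: False
      then show ?thesis using less.prems(3)[OF that] unfolding rem by simp
    qed
    have bag: "\<exists>r\<in>V - {s}. u \<in> X r \<and> v \<in> X r" if uv: "u \<in> W" "v \<in> W" "N u v" for u v
    proof -
      obtain r where r: "r \<in> V" "u \<in> X r" "v \<in> X r" using less.prems(4)[OF uv] by auto
      show ?thesis
      proof (cases "r = s")
        case True
        have nb: "\<exists>a. a \<in> V \<and> w \<in> X a \<and> (s, a) \<in> R" if "w \<in> W" "w \<in> X s" for w
        proof -
          have "s \<in> {r \<in> V. w \<in> X r}" "{r \<in> V. w \<in> X r} \<noteq> {s}"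
            using that s(1) False by blast+
          with connected_on_neighbour[OF less.prems(3)[OF that(1)]] show ?thesis
            by (metis (mono_tags, lifting) mem_Collect_eq)
        qed
        \<comment> \<open>By connectedness both vertices occur in a neighbour of the leaf. There is
          only one, and its bag covers the pair again.\<close>
        obtain a where a: "a \<in> V" "u \<in> X a" "(s, a) \<in> R"
          using nb[OF uv(1)] True r by auto
        obtain b where b: "b \<in> V" "v \<in> X b" "(s, b) \<in> R"
          using nb[OF uv(2)] True r by auto
        have "a = b" using s a b by blast
        moreover have "a \<noteq> s" using a assms(3) by (auto simp: irrefl_def)
        ultimately show ?thesis using a b by blast
      qed (use r in auto)
    qed
    have "card (V - {s}) < card V" using s less.prems(1) by (meson card_Diff1_less)
    then have "\<exists>v\<in>W. \<exists>r\<in>V - {s}. v \<in> X r \<and> (\<forall>u\<in>W. N v u \<longrightarrow> u \<in> X r)"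
      by (rule less.hyps)
        (use less.prems(1) con bag cycle_free_subset[OF less.prems(2), of "V - {s}"] in simp_all)
    then show ?thesis by auto
  qed
qed

section \<open>Translation between relations and digraphs\<close>

lemma (in wf_digraph) awalk_of_vertices:
  assumes "p \<noteq> []" "set p \<subseteq> verts G" "successively (\<lambda>a b. a \<rightarrow> b) p"
  shows "\<exists>q. awalk (hd p) q (last p) \<and> awalk_verts (hd p) q = p"
  using assms
proof (induction p)
  case (Cons a p)
  show ?case
  proof (cases "p = []")
    case True
    then show ?thesis using Cons.prems by (auto intro!: exI[of _ "[]"] simp: awalk_Nil_iff)
  next
    case False
    then obtain q where q: "awalk (hd p) q (last p)" "awalk_verts (hd p) q = p"
      using Cons by (auto simp: successively_Cons)
    have "a \<rightarrow> hd p" using Cons.prems False by (auto simp: successively_Cons)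
    then obtain e where "e \<in> arcs G" "tail G e = a" "head G e = hd p" by auto
    then have "awalk a (e # q) (last p)" "awalk_verts a (e # q) = a # p"
      using q by (auto simp: awalk_Cons_iff)
    then show ?thesis using False by (intro exI[of _ "e # q"]) simp
  qed
qed simp

lemma is_tree_imp_cycle_free:
  assumes "is_tree T"
  shows "cycle_free (arcs_ends T) (verts T)"
  unfolding cycle_free_def
proof
  interpret graph T using assms by (simp add: is_tree_def)
  assume "\<exists>p. 3 \<le> length p \<and> distinct p \<and> set p \<subseteq> verts T \<and>
     successively (\<lambda>a b. (a, b) \<in> arcs_ends T) p \<and> (last p, hd p) \<in> arcs_ends T"
  then obtain p where p: "3 \<le> length p" "distinct p" "set p \<subseteq> verts T"
    "successively (\<lambda>a b. (a, b) \<in> arcs_ends T) p" "(last p, hd p) \<in> arcs_ends T"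
    by blast
  then have "p \<noteq> []" by auto
  then obtain q where q: "awalk (hd p) q (last p)" "awalk_verts (hd p) q = p"
    using awalk_of_vertices p by blast
  obtain e where e: "e \<in> arcs T" "tail T e = last p" "head T e = hd p"
    using p(5) by auto
  \<comment> \<open>The closing arc is put in front: only the tail of the vertex list of a
    \<open>cycle\<close> has to be distinct, and here that tail is \<open>p\<close>.\<close>
  have "awalk (last p) (e # q) (last p)"
    using e q by (auto simp: awalk_Cons_iff)
  moreover have "tl (awalk_verts (last p) (e # q)) = p" using q e by simp
  ultimately have "pre_digraph.cycle T (e # q)"
    unfolding cycle_def using p(2) by (intro exI[of _ "last p"]) auto
  moreover have "3 \<le> length (e # q)"
    using arg_cong[OF q(2), of length] p(1) by (simp add: length_awalk_verts)
  ultimately show False using assms unfolding is_tree_def by blast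
qed

lemma (in graph) sym_arcs_ends: "sym (arcs_ends G)"
  using sym_arcs by (simp add: symmetric_def)

lemma (in graph) irrefl_arcs_ends: "irrefl (arcs_ends G)"
  by (auto simp: irrefl_def dest: adj_not_same)

lemma arcs_ends_induce_subgraph: "arcs_ends (G \<restriction> C) = arcs_ends G \<inter> C \<times> C"
  by (auto simp: arcs_ends_conv)

lemma symcl_sym: "sym R \<Longrightarrow> R\<^sup>s = R"
  by (auto simp: symcl_def dest: symD)

text \<open>Connectedness of digraphs unfolds to \<open>rtrancl_on\<close>, which is reflexive only
  inside the vertex set, whereas \<open>rtrancl\<close> is reflexive everywhere; hence the conjunct
  \<open>u \<in> C\<close>.\<close>

lemma rtrancl_on_iff_Restr:
  "(u, v) \<in> rtrancl_on C (R \<inter> C \<times> C) \<longleftrightarrow> u \<in> C \<and> (u, v) \<in> (R \<inter> C \<times> C)\<^sup>*"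
proof
  assume "(u, v) \<in> rtrancl_on C (R \<inter> C \<times> C)"
  then show "u \<in> C \<and> (u, v) \<in> (R \<inter> C \<times> C)\<^sup>*"
    using rtrancl_on_rtranclI in_rtrancl_on_in_F by metis
next
  assume "u \<in> C \<and> (u, v) \<in> (R \<inter> C \<times> C)\<^sup>*"
  then have "(u, v) \<in> (R \<inter> C \<times> C)\<^sup>*" "u \<in> C" by auto
  then show "(u, v) \<in> rtrancl_on C (R \<inter> C \<times> C)"
    by induction (auto intro: rtrancl_on_into_rtrancl_on)
qed

lemma (in graph) connected_induce_subgraph_iff:
  "Digraph_Component.connected (G \<restriction> C) \<longleftrightarrow> connected_on (arcs_ends G) C"
proof -
  have "(arcs_ends (G \<restriction> C))\<^sup>s = arcs_ends G \<inter> C \<times> C"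
    unfolding arcs_ends_induce_subgraph
    by (rule symcl_sym) (use sym_arcs_ends in \<open>auto simp: sym_def\<close>)
  then show ?thesis
    by (auto simp: connected_conv connected_on_def rtrancl_on_iff_Restr)
qed

section \<open>Independence numbers of decompositions\<close>

lemma card_le_independence_number:
  "finite (verts G) \<Longrightarrow> I \<in> independent_sets G \<Longrightarrow> card I \<le> independence_number G"
  unfolding independence_number_def by (simp add: finite_independent_sets)

lemma independence_number_le:
  assumes "finite (verts G)" "\<And>I. I \<in> independent_sets G \<Longrightarrow> card I \<le> k"
  shows "independence_number G \<le> k"
proof -
  have "{} \<in> independent_sets G" by (simp add: independent_sets_def)
  then show ?thesis unfolding independence_number_def
    using assms by (subst Max_le_iff) (auto simp: finite_independent_sets)
qed

lemma tree_decomposition_complete_bipartite: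
  assumes td: "tree_decomposition G T X" and fin: "finite (verts G)"
    and A: "A \<in> independent_sets G" "card A = k" and B: "B \<in> independent_sets G" "card B = k"
    and AB: "\<And>a b. a \<in> A \<Longrightarrow> b \<in> B \<Longrightarrow> a \<rightarrow>\<^bsub>G\<^esub> b \<and> b \<rightarrow>\<^bsub>G\<^esub> a"
  shows "k \<le> decomposition_independence_number G T X"
proof (cases "k = 0")
  case False
  interpret T: graph T using td by (simp add: tree_decomposition_def is_tree_def)
  have sub: "A \<subseteq> verts G" "B \<subseteq> verts G" using A B by (auto simp: independent_sets_def)
  have "\<exists>v\<in>A \<union> B. \<exists>s\<in>verts T. v \<in> X s \<and> (\<forall>u\<in>A \<union> B. v \<rightarrow>\<^bsub>G\<^esub> u \<longrightarrow> u \<in> X s)"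
  proof (rule closed_neighbourhood_in_bag)
    show "cycle_free (arcs_ends T) (verts T)"
      using td by (simp add: tree_decomposition_def is_tree_imp_cycle_free)
    show "A \<union> B \<noteq> {}" using A False by auto
    show "connected_on (arcs_ends T) {s \<in> verts T. v \<in> X s}" if "v \<in> A \<union> B" for v
      using td sub that unfolding T.connected_induce_subgraph_iff[symmetric] tree_decomposition_def
      by blast
    show "\<exists>s\<in>verts T. u \<in> X s \<and> v \<in> X s" if "u \<rightarrow>\<^bsub>G\<^esub> v" for u v
      using td that unfolding tree_decomposition_def by blast
  qed (auto intro: T.sym_arcs_ends T.irrefl_arcs_ends)
  then obtain v s where v: "v \<in> A \<union> B" "s \<in> verts T" "\<forall>u\<in>A \<union> B. v \<rightarrow>\<^bsub>G\<^esub> u \<longrightarrow> u \<in> X s"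
    by blast
  obtain D where D: "D \<in> {A, B}" "D \<subseteq> X s"
  proof (cases "v \<in> A")
    case True
    then show ?thesis using v AB that[of B] by blast
  next
    case False
    then show ?thesis using v AB that[of A] by blast
  qed
  have fX: "finite (X s)"
    using td v(2) fin unfolding tree_decomposition_def by (meson finite_subset)
  have "D \<in> independent_sets (G \<restriction> X s)"
    using D A(1) B(1) unfolding independent_sets_def by (auto simp: arcs_ends_induce_subgraph)
  moreover have "card D = k" using D A B by blast
  ultimately have "k \<le> independence_number (G \<restriction> X s)"
    using card_le_independence_number[of "G \<restriction> X s" D] fX by simp
  also have "\<dots> \<le> decomposition_independence_number G T X"
    unfolding decomposition_independence_number_def by (rule Max_ge) (simp_all add: v(2))
  finally show ?thesis .
qed simp

lemma tree_alpha_eqI: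
  fixes T :: "(nat, nat \<times> nat) pre_digraph"
  assumes td: "tree_decomposition G T X" and fin: "finite (verts G)"
    and le: "\<And>s I. s \<in> verts T \<Longrightarrow> I \<in> independent_sets G \<Longrightarrow> I \<subseteq> X s \<Longrightarrow> card I \<le> k"
    and A: "A \<in> independent_sets G" "card A = k" and B: "B \<in> independent_sets G" "card B = k"
    and AB: "\<And>a b. a \<in> A \<Longrightarrow> b \<in> B \<Longrightarrow> a \<rightarrow>\<^bsub>G\<^esub> b \<and> b \<rightarrow>\<^bsub>G\<^esub> a"
  shows "tree_alpha G = k"
proof -
  interpret T: graph T using td by (simp add: tree_decomposition_def is_tree_def)
  have lower: "k \<le> decomposition_independence_number G S Y" if "tree_decomposition G S Y"
    for S :: "(nat, nat \<times> nat) pre_digraph" and Y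
    by (rule tree_decomposition_complete_bipartite[OF that fin A B AB])
  have "verts T \<noteq> {}" using td
    by (simp add: tree_decomposition_def is_tree_def connected_conv)
  moreover have "independence_number (G \<restriction> X s) \<le> k" if s: "s \<in> verts T" for s
  proof (rule independence_number_le)
    have "X s \<subseteq> verts G" using td s by (simp add: tree_decomposition_def)
    then show "finite (verts (G \<restriction> X s))" using fin by (simp add: finite_subset)
    show "card I \<le> k" if I: "I \<in> independent_sets (G \<restriction> X s)" for I
    proof (rule le[OF s])
      show "I \<subseteq> X s" using I by (simp add: independent_sets_def)
      then show "I \<in> independent_sets G"
        using I \<open>X s \<subseteq> verts G\<close>
        unfolding independent_sets_def arcs_ends_induce_subgraph by blast
    qed
  qed
  ultimately have "decomposition_independence_number G T X \<le> k"
    unfolding decomposition_independence_number_def by (intro Max.boundedI) auto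
  \<comment> \<open>\<open>tree_alpha\<close> is a least attained value, so the given decomposition
    must have the number \<open>k\<close> exactly. The general lower bound, applied to it, supplies
    the other half.\<close>
  then have eq: "decomposition_independence_number G T X = k"
    by (rule antisym) (rule lower[OF td])
  show ?thesis unfolding tree_alpha_def
  proof (rule Least_equality)
    show "\<exists>(T :: (nat, nat \<times> nat) pre_digraph) X.
        tree_decomposition G T X \<and> decomposition_independence_number G T X = k"
      using td eq by (intro exI conjI)
  qed (use lower in auto)
qed

section \<open>Mixing of the Glauber dynamics\<close>

lemma prob_bind_pmf:
  "measure_pmf.prob (bind_pmf p f) A = measure_pmf.expectation p (\<lambda>x. measure_pmf.prob (f x) A)"
proof -
  have "ennreal (measure_pmf.prob (bind_pmf p f) A) = (\<integral>\<^sup>+x. ennreal (measure_pmf.prob (f x) A) \<partial>p)"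
    by (simp add: measure_pmf.emeasure_eq_measure[symmetric])
  also have "\<dots> = ennreal (measure_pmf.expectation p (\<lambda>x. measure_pmf.prob (f x) A))"
    by (rule nn_integral_eq_integral)
      (auto intro!: measure_pmf.integrable_const_bound[where B = 1] AE_pmfI)
  finally show ?thesis by simp
qed

lemma integrable_prob: "integrable (measure_pmf p) (\<lambda>x. measure_pmf.prob (f x) A)"
  by (rule measure_pmf.integrable_const_bound[where B = 1]) auto

lemma integrable_indicator_pmf: "integrable (measure_pmf p) (indicator A :: _ \<Rightarrow> real)"
  by (rule measure_pmf.integrable_const_bound[where B = 1]) auto

lemma expectation_mono_on:
  assumes "integrable (measure_pmf p) f" "integrable (measure_pmf p) g"
    and "\<And>x. x \<in> set_pmf p \<Longrightarrow> f x \<le> (g x :: real)"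
  shows "measure_pmf.expectation p f \<le> measure_pmf.expectation p g"
  by (rule integral_mono_AE) (use assms in \<open>auto intro: AE_pmfI\<close>)

lemma pmf_bind_ge: "pmf p x * pmf (f x) y \<le> pmf (bind_pmf p f) y"
proof -
  have "measure_pmf.expectation p (\<lambda>z. pmf (f x) y * indicator {x} z)
      \<le> measure_pmf.expectation p (\<lambda>z. pmf (f z) y)"
    by (rule expectation_mono_on)
      (auto intro!: measure_pmf.integrable_const_bound[where B = 1] AE_pmfI
        simp: pmf_le_1 indicator_def)
  then show ?thesis by (simp add: pmf_bind measure_pmf_single mult.commute)
qed

text \<open>The bound depends on \<open>p\<close> only through \<open>e\<close>, \<open>x\<close>
  and \<open>a\<close>. Together with its upper counterpart it confines the averages over all laws
  with mass at least \<open>e\<close> at \<open>x\<close> to one interval of length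
  \<open>(1 - e) * (b - a)\<close>.\<close>

lemma expectation_ge_atom:
  assumes "\<And>y. y \<in> set_pmf p \<Longrightarrow> a \<le> f y" "x \<in> set_pmf p" "e \<le> pmf p x"
    and "integrable (measure_pmf p) f"
  shows "e * f x + (1 - e) * a \<le> measure_pmf.expectation p f"
proof -
  have "e * (f x - a) \<le> pmf p x * (f x - a)"
    using assms(1)[OF assms(2)] assms(3) by (intro mult_right_mono) auto
  then have "e * f x + (1 - e) * a \<le> a + (f x - a) * pmf p x"
    by (simp add: algebra_simps)
  also have "\<dots> = measure_pmf.expectation p (\<lambda>z. a + (f x - a) * indicator {x} z)"
    by (subst Bochner_Integration.integral_add)
      (auto simp: measure_pmf_single intro!: measure_pmf.integrable_const_bound[where B = 1])
  also have "\<dots> \<le> measure_pmf.expectation p f"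
  proof (rule expectation_mono_on)
    show "integrable (measure_pmf p) (\<lambda>z. a + (f x - a) * indicator {x} z)"
      by (intro Bochner_Integration.integrable_add integrable_mult_right
          integrable_indicator_pmf) auto
  qed (use assms in \<open>auto simp: indicator_def\<close>)
  finally show ?thesis .
qed

lemma expectation_le_atom:
  assumes "\<And>y. y \<in> set_pmf p \<Longrightarrow> f y \<le> b" "x \<in> set_pmf p" "e \<le> pmf p x"
    and "integrable (measure_pmf p) f"
  shows "measure_pmf.expectation p f \<le> e * f x + (1 - e) * (b :: real)"
proof -
  have "e * (- f x) + (1 - e) * (- b) \<le> measure_pmf.expectation p (\<lambda>z. - f z)"
    by (rule expectation_ge_atom) (use assms in auto)
  then show ?thesis by (simp add: algebra_simps)
qed

text \<open>Detailed balance: summing over \<open>x\<close> leaves \<open>pmf p y\<close> times the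
  total mass of \<open>K y\<close>, which is 1.\<close>

lemma bind_pmf_reversible:
  assumes "\<And>x y. pmf p x * pmf (K x) y = pmf p y * pmf (K y) x"
  shows "bind_pmf p K = p"
proof (rule pmf_eqI)
  fix y
  have "ennreal (pmf (bind_pmf p K) y) = (\<integral>\<^sup>+x. ennreal (pmf p x * pmf (K x) y) \<partial>count_space UNIV)"
    by (simp add: ennreal_pmf_bind nn_integral_measure_pmf ennreal_mult'')
  also have "\<dots> = (\<integral>\<^sup>+x. ennreal (pmf p y) * ennreal (pmf (K y) x) \<partial>count_space UNIV)"
    by (subst assms) (simp add: ennreal_mult'')
  also have "\<dots> = ennreal (pmf p y)"
    by (subst nn_integral_cmult) (auto simp: nn_integral_pmf measure_pmf.emeasure_space_1[simplified])
  finally show "pmf (bind_pmf p K) y = pmf p y" by simp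
qed

lemma tv_dist_le_iff:
  "tv_dist p q \<le> e \<longleftrightarrow> (\<forall>A. \<bar>measure_pmf.prob p A - measure_pmf.prob q A\<bar> \<le> e)"
proof -
  have "\<bar>measure_pmf.prob p A - measure_pmf.prob q A\<bar> \<le> 1" for A
    using measure_pmf.prob_le_1[of p A] measure_pmf.prob_le_1[of q A]
      measure_nonneg[of p A] measure_nonneg[of q A] by linarith
  then have "bdd_above (range (\<lambda>A. \<bar>measure_pmf.prob p A - measure_pmf.prob q A\<bar>))"
    by (auto intro!: bdd_aboveI2)
  then show ?thesis unfolding tv_dist_def by (simp add: cSUP_le_iff)
qed

section \<open>Single-site updates and stationarity\<close>

text \<open>The update at a fixed vertex has at most two outcomes, which makes detailed balance easy
  to check. Stationarity then passes to the uniformly chosen vertex, because this choice commutes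
  with the draw of the state.\<close>

definition glauber_site :: "('a, 'b) pre_digraph \<Rightarrow> real \<Rightarrow> 'a \<Rightarrow> 'a set \<Rightarrow> 'a set pmf" where
  "glauber_site G lam v I = (if v \<in> I then
       map_pmf (\<lambda>b. if b then I - {v} else I) (bernoulli_pmf (1 / (lam + 1)))
     else if insert v I \<in> independent_sets G then
       map_pmf (\<lambda>b. if b then insert v I else I) (bernoulli_pmf (lam / (lam + 1)))
     else return_pmf I)"

lemma glauber_step_site:
  "glauber_step G lam I = bind_pmf (pmf_of_set (verts G)) (\<lambda>v. glauber_site G lam v I)"
  by (simp add: glauber_step_def glauber_site_def)

lemma pmf_map_bernoulli:
  assumes "0 \<le> q" "q \<le> 1"
  shows "pmf (map_pmf (\<lambda>b. if b then x else y) (bernoulli_pmf q)) z =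
    (if x = z then q else 0) + (if y = z then 1 - q else 0)"
  using assms by (simp add: map_pmf_def pmf_bind)

lemma pmf_glauber_site:
  assumes "0 < lam"
  shows "pmf (glauber_site G lam v I) J =
    (if v \<in> I then (if I - {v} = J then 1 / (lam + 1) else 0) + (if I = J then lam / (lam + 1) else 0)
     else if insert v I \<in> independent_sets G then
       (if insert v I = J then lam / (lam + 1) else 0) + (if I = J then 1 / (lam + 1) else 0)
     else if I = J then 1 else 0)"
proof -
  have "1 - 1 / (lam + 1) = lam / (lam + 1)" "1 - lam / (lam + 1) = 1 / (lam + 1)"
    using assms by (simp_all add: field_simps)
  then show ?thesis
    using assms unfolding glauber_site_def
    by (simp add: pmf_map_bernoulli)
qed

lemma independent_sets_subset: "I \<in> independent_sets G \<Longrightarrow> J \<subseteq> I \<Longrightarrow> J \<in> independent_sets G"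
  unfolding independent_sets_def by blast

lemma empty_independent: "{} \<in> independent_sets G"
  by (simp add: independent_sets_def)

lemma set_pmf_glauber_site:
  assumes "0 < lam" "J \<in> set_pmf (glauber_site G lam v I)"
  shows "J = I \<or> v \<in> I \<and> J = I - {v} \<or> v \<notin> I \<and> insert v I \<in> independent_sets G \<and> J = insert v I"
  using assms(2) unfolding set_pmf_iff pmf_glauber_site[OF assms(1)] by (auto split: if_splits)

text \<open>With \<open>c = card (I - {v})\<close> and the partition function \<open>Z\<close>, both
  sides equal \<open>lam^(c + 1) / (Z * (lam + 1))\<close>.\<close>

lemma glauber_site_remove_reversible:
  assumes "finite (verts G)" "0 < lam" "I \<in> independent_sets G" "v \<in> I"
  shows "pmf (hardcore_pmf G lam) I * pmf (glauber_site G lam v I) (I - {v}) =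
    pmf (hardcore_pmf G lam) (I - {v}) * pmf (glauber_site G lam v (I - {v})) I"
proof -
  have I: "I - {v} \<in> independent_sets G" "insert v (I - {v}) = I" "I \<noteq> I - {v}" "I - {v} \<noteq> I"
    using assms(3,4) by (auto intro: independent_sets_subset)
  have "finite I" using assms by (auto simp: independent_sets_def intro: finite_subset)
  then obtain c where "card (I - {v}) = c" "card I = Suc c"
    using assms(4) by (metis card_Suc_Diff1)
  then show ?thesis
    using assms(1-4) I by (simp add: pmf_glauber_site pmf_hardcore del: card_Diff_insert)
qed

lemma bind_glauber_site_hardcore:
  assumes "finite (verts G)" "0 < lam"
  shows "bind_pmf (hardcore_pmf G lam) (glauber_site G lam v) = hardcore_pmf G lam"
proof (rule bind_pmf_reversible)
  fix I J
  let ?w = "\<lambda>I J. pmf (hardcore_pmf G lam) I * pmf (glauber_site G lam v I) J"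
  let ?r = "\<lambda>I J. I \<in> independent_sets G \<and> v \<in> I \<and> J = I - {v}"
  have zero: "?w I J = 0" if "I \<noteq> J" "\<not> ?r I J" "\<not> ?r J I" for I J
  proof (cases "I \<in> independent_sets G")
    case True
    have "J \<notin> set_pmf (glauber_site G lam v I)"
      using set_pmf_glauber_site[OF assms(2), of J G v I] that True by auto
    then show ?thesis by (simp add: set_pmf_iff)
  next
    case False
    then show ?thesis using assms by (simp add: pmf_hardcore)
  qed
  consider "I = J" | "?r I J" | "?r J I" | "I \<noteq> J" "\<not> ?r I J" "\<not> ?r J I" by blast
  then show "?w I J = ?w J I"
  proof cases
    case 2
    then show ?thesis using glauber_site_remove_reversible[OF assms] by auto
  next
    case 3
    then show ?thesis using glauber_site_remove_reversible[OF assms, of J v] by auto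
  next
    case 4
    then show ?thesis using zero[of I J] zero[of J I] by auto
  qed auto
qed

lemma bind_glauber_step_hardcore:
  assumes "finite (verts G)" "0 < lam"
  shows "bind_pmf (hardcore_pmf G lam) (glauber_step G lam) = hardcore_pmf G lam"
proof -
  have "bind_pmf (hardcore_pmf G lam) (glauber_step G lam) =
    bind_pmf (pmf_of_set (verts G)) (\<lambda>v. bind_pmf (hardcore_pmf G lam) (glauber_site G lam v))"
    unfolding glauber_step_site[abs_def] by (rule bind_commute_pmf)
  then show ?thesis by (simp add: bind_glauber_site_hardcore[OF assms])
qed

lemma glauber_dist_0: "glauber_dist G lam I 0 = return_pmf I"
  by (simp add: glauber_dist_def)

lemma glauber_dist_Suc:
  "glauber_dist G lam I (Suc k) = bind_pmf (glauber_dist G lam I k) (glauber_step G lam)"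
  by (simp add: glauber_dist_def)

lemma glauber_dist_1: "glauber_dist G lam I (Suc 0) = glauber_step G lam I"
  by (simp add: glauber_dist_0 glauber_dist_Suc bind_return_pmf)

lemma glauber_dist_add:
  "glauber_dist G lam I (j + k) = bind_pmf (glauber_dist G lam I j) (\<lambda>J. glauber_dist G lam J k)"
  by (induction k)
    (simp_all add: glauber_dist_0 glauber_dist_Suc bind_return_pmf' bind_assoc_pmf[symmetric])

lemma bind_glauber_dist_hardcore:
  assumes "finite (verts G)" "0 < lam"
  shows "bind_pmf (hardcore_pmf G lam) (\<lambda>I. glauber_dist G lam I k) = hardcore_pmf G lam"
  by (induction k)
    (simp_all add: glauber_dist_0 glauber_dist_Suc bind_return_pmf' bind_assoc_pmf[symmetric]
      bind_glauber_step_hardcore[OF assms])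

lemma set_pmf_hardcore:
  assumes "finite (verts G)" "0 < lam"
  shows "set_pmf (hardcore_pmf G lam) \<subseteq> independent_sets G"
  using assms by (auto simp: set_pmf_iff pmf_hardcore split: if_splits)

lemma set_pmf_glauber_step:
  assumes "finite (verts G)" "verts G \<noteq> {}" "0 < lam"
    and "J \<in> set_pmf (glauber_step G lam I)"
  obtains v where "v \<in> verts G" "J \<in> set_pmf (glauber_site G lam v I)"
  using assms by (auto simp: glauber_step_site set_pmf_of_set)

lemma glauber_step_independent:
  assumes "finite (verts G)" "verts G \<noteq> {}" "0 < lam" "I \<in> independent_sets G"
    and "J \<in> set_pmf (glauber_step G lam I)"
  shows "J \<in> independent_sets G"
proof -
  obtain v where "J \<in> set_pmf (glauber_site G lam v I)"
    using set_pmf_glauber_step[OF assms(1-3,5)] by blast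
  from set_pmf_glauber_site[OF assms(3) this] show ?thesis
    using assms(4) independent_sets_subset[OF assms(4), of "I - {v}"] by auto
qed

lemma glauber_dist_independent:
  assumes "finite (verts G)" "verts G \<noteq> {}" "0 < lam" "I \<in> independent_sets G"
  shows "set_pmf (glauber_dist G lam I k) \<subseteq> independent_sets G"
  by (induction k)
    (use assms glauber_step_independent[OF assms(1-3)] in \<open>auto simp: glauber_dist_0 glauber_dist_Suc\<close>)

section \<open>Convergence of the dynamics\<close>

lemma pmf_glauber_step_remove_ge:
  assumes "finite (verts G)" "verts G \<noteq> {}" "0 < lam" "I \<in> independent_sets G"
  shows "\<exists>J\<in>independent_sets G. card J \<le> card I - 1 \<and>
    1 / (real (card (verts G)) * (lam + 1)) \<le> pmf (glauber_step G lam I) J"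
proof -
  have fin: "finite I" using assms by (auto simp: independent_sets_def intro: finite_subset)
  \<comment> \<open>From the empty set any vertex serves: it is refused with probability at least
    \<open>1 / (lam + 1)\<close>, and the truncated \<open>card I - 1\<close> admits
    \<open>J = {}\<close>.\<close>
  obtain v where v: "v \<in> verts G" "I \<noteq> {} \<longrightarrow> v \<in> I"
  proof (cases "I = {}")
    case True
    then show ?thesis using assms(2) that by auto
  next
    case False
    then show ?thesis using assms(4) that by (auto simp: independent_sets_def)
  qed
  have "1 / (lam + 1) \<le> pmf (glauber_site G lam v I) (I - {v})"
    using v assms(3) by (cases "I = {}") (auto simp: pmf_glauber_site field_simps)
  then have "1 / real (card (verts G)) * (1 / (lam + 1)) \<le>
      pmf (pmf_of_set (verts G)) v * pmf (glauber_site G lam v I) (I - {v})"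
    using v assms by (intro mult_mono) auto
  also have "\<dots> \<le> pmf (glauber_step G lam I) (I - {v})"
    unfolding glauber_step_site by (rule pmf_bind_ge)
  finally have "1 / (real (card (verts G)) * (lam + 1)) \<le> pmf (glauber_step G lam I) (I - {v})"
    by simp
  moreover have "card (I - {v}) \<le> card I - 1"
    using v fin by (cases "I = {}") auto
  moreover have "I - {v} \<in> independent_sets G"
    using assms(4) by (auto intro: independent_sets_subset)
  ultimately show ?thesis by blast
qed

text \<open>One prescribed removal per step leads to the empty set, where surplus steps are spent.
  Hence the same \<open>k\<close>, namely the number of vertices, can serve all starting
  sets.\<close>

lemma pmf_glauber_dist_empty_ge:
  assumes "finite (verts G)" "verts G \<noteq> {}" "0 < lam" "I \<in> independent_sets G" "card I \<le> k"
  shows "(1 / (real (card (verts G)) * (lam + 1))) ^ k \<le> pmf (glauber_dist G lam I k) {}"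
  using assms(4,5)
proof (induction k arbitrary: I)
  case 0
  then have "I = {}" using assms(1) by (auto simp: independent_sets_def dest: finite_subset)
  then show ?case by (simp add: glauber_dist_0)
next
  case (Suc k)
  let ?d = "1 / (real (card (verts G)) * (lam + 1))"
  obtain J where J: "J \<in> independent_sets G" "card J \<le> card I - 1" "?d \<le> pmf (glauber_step G lam I) J"
    using pmf_glauber_step_remove_ge[OF assms(1-3) Suc.prems(1)] by blast
  have "?d ^ k \<le> pmf (glauber_dist G lam J k) {}"
    using Suc J by auto
  with J(3) have "?d * ?d ^ k \<le> pmf (glauber_step G lam I) J * pmf (glauber_dist G lam J k) {}"
    using assms(3) by (intro mult_mono) auto
  also have "\<dots> \<le> pmf (bind_pmf (glauber_step G lam I) (\<lambda>J. glauber_dist G lam J k)) {}"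
    by (rule pmf_bind_ge)
  also have "bind_pmf (glauber_step G lam I) (\<lambda>J. glauber_dist G lam J k) = glauber_dist G lam I (Suc k)"
    using glauber_dist_add[of G lam I "Suc 0" k] by (simp add: glauber_dist_1)
  finally show ?case by simp
qed

text \<open>Doeblin's argument: within card (verts G) steps every start reaches the empty set with
  probability at least e, so that many steps shrink the oscillation by the factor 1 - e.\<close>

lemma glauber_dist_oscillation:
  assumes G: "finite (verts G)" "verts G \<noteq> {}" "0 < lam"
    and e: "e = (1 / (real (card (verts G)) * (lam + 1))) ^ card (verts G)"
  shows "\<exists>a b. b - a \<le> (1 - e) ^ q \<and> (\<forall>I\<in>independent_sets G.
    a \<le> measure_pmf.prob (glauber_dist G lam I (q * card (verts G))) A \<and>
    measure_pmf.prob (glauber_dist G lam I (q * card (verts G))) A \<le> b)"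
proof (induction q)
  case 0
  show ?case by (intro exI[of _ 0] exI[of _ 1]) auto
next
  case (Suc q)
  let ?n = "card (verts G)"
  let ?f = "\<lambda>I. measure_pmf.prob (glauber_dist G lam I (q * ?n)) A"
  obtain a b where ab: "b - a \<le> (1 - e) ^ q"
    "\<And>I. I \<in> independent_sets G \<Longrightarrow> a \<le> ?f I" "\<And>I. I \<in> independent_sets G \<Longrightarrow> ?f I \<le> b"
    using Suc by blast
  have e0: "0 < e" using G by (simp add: e card_gt_0_iff)
  have e1: "e \<le> pmf (glauber_dist G lam I ?n) {}" if "I \<in> independent_sets G" for I
    unfolding e using that G
    by (intro pmf_glauber_dist_empty_ge) (auto simp: independent_sets_def intro: card_mono)
  then have "e \<le> 1" using order.trans[OF e1[OF empty_independent] pmf_le_1] by blast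
  have 1: "measure_pmf.prob (glauber_dist G lam I (Suc q * ?n)) A =
      measure_pmf.expectation (glauber_dist G lam I ?n) ?f" for I
    by (simp add: glauber_dist_add prob_bind_pmf)
  have supp: "{} \<in> set_pmf (glauber_dist G lam I ?n)" if "I \<in> independent_sets G" for I
    using e1[OF that] e0 by (simp add: set_pmf_iff)
  let ?a = "e * ?f {} + (1 - e) * a" and ?b = "e * ?f {} + (1 - e) * b"
  have "?b - ?a = (1 - e) * (b - a)" by (simp add: algebra_simps)
  also have "\<dots> \<le> (1 - e) ^ Suc q" using ab(1) \<open>e \<le> 1\<close> by (simp add: mult_left_mono)
  finally have "?b - ?a \<le> (1 - e) ^ Suc q" .
  moreover have "?a \<le> measure_pmf.prob (glauber_dist G lam I (Suc q * ?n)) A"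
    if I: "I \<in> independent_sets G" for I
    unfolding 1 using ab(2) glauber_dist_independent[OF G I] supp[OF I] e1[OF I]
    by (intro expectation_ge_atom integrable_prob) blast+
  moreover have "measure_pmf.prob (glauber_dist G lam I (Suc q * ?n)) A \<le> ?b"
    if I: "I \<in> independent_sets G" for I
    unfolding 1 using ab(3) glauber_dist_independent[OF G I] supp[OF I] e1[OF I]
    by (intro expectation_le_atom integrable_prob) blast+
  ultimately show ?case by blast
qed

text \<open>\<open>mixing_time\<close> is a \<open>LEAST\<close>, so nothing can be said about it
  before some time is known to satisfy its condition. By stationarity the equilibrium probability of
  \<open>A\<close> is an average of the probabilities after \<open>k\<close> steps and thus lies
  between the same two bounds as all of them.\<close>

lemma ex_mixing:
  assumes G: "finite (verts G)" "verts G \<noteq> {}" "0 < lam"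
  shows "\<exists>k. \<forall>I\<in>independent_sets G. tv_dist (glauber_dist G lam I k) (hardcore_pmf G lam) \<le> 1 / 4"
proof -
  define e where "e = (1 / (real (card (verts G)) * (lam + 1))) ^ card (verts G)"
  have "0 < e" using G by (simp add: e_def card_gt_0_iff)
  have "1 \<le> real (card (verts G))" using G by (simp add: Suc_leI card_gt_0_iff)
  then have "1 * 1 \<le> real (card (verts G)) * (lam + 1)"
    using G(3) by (intro mult_mono) auto
  then have "e \<le> 1" unfolding e_def by (intro power_le_one) auto
  obtain q where q: "(1 - e) ^ q < 1 / 4"
    using real_arch_pow_inv[of "1/4" "1 - e"] \<open>0 < e\<close> by auto
  let ?k = "q * card (verts G)"
  have "\<bar>measure_pmf.prob (glauber_dist G lam I ?k) A - measure_pmf.prob (hardcore_pmf G lam) A\<bar> \<le> 1 / 4"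
    if I: "I \<in> independent_sets G" for I A
  proof -
    let ?f = "\<lambda>I. measure_pmf.prob (glauber_dist G lam I ?k) A"
    obtain a b where ab: "b - a \<le> (1 - e) ^ q"
      "\<And>I. I \<in> independent_sets G \<Longrightarrow> a \<le> ?f I" "\<And>I. I \<in> independent_sets G \<Longrightarrow> ?f I \<le> b"
      using glauber_dist_oscillation[OF G e_def, of q A] by blast
    have p: "measure_pmf.prob (hardcore_pmf G lam) A = measure_pmf.expectation (hardcore_pmf G lam) ?f"
      by (simp add: prob_bind_pmf[symmetric] bind_glauber_dist_hardcore[OF G(1,3)])
    have "measure_pmf.expectation (hardcore_pmf G lam) (\<lambda>_. a) \<le> measure_pmf.expectation (hardcore_pmf G lam) ?f"
      by (rule expectation_mono_on) (use ab set_pmf_hardcore[OF G(1,3)] in \<open>auto intro: integrable_prob\<close>)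
    moreover have "measure_pmf.expectation (hardcore_pmf G lam) ?f \<le> measure_pmf.expectation (hardcore_pmf G lam) (\<lambda>_. b)"
      by (rule expectation_mono_on) (use ab set_pmf_hardcore[OF G(1,3)] in \<open>auto intro: integrable_prob\<close>)
    ultimately show ?thesis
      unfolding p abs_le_iff using ab(1) ab(2)[OF I] ab(3)[OF I] q by simp
  qed
  then show ?thesis unfolding tv_dist_le_iff by blast
qed

lemma tv_dist_mixing_time:
  assumes "finite (verts G)" "verts G \<noteq> {}" "0 < lam" "I \<in> independent_sets G"
  shows "tv_dist (glauber_dist G lam I (mixing_time G lam)) (hardcore_pmf G lam) \<le> 1 / 4"
proof -
  let ?P = "\<lambda>k. \<forall>I\<in>independent_sets G. tv_dist (glauber_dist G lam I k) (hardcore_pmf G lam) \<le> 1 / 4"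
  have "?P (LEAST k. ?P k)"
    using ex_mixing[OF assms(1-3)] by (rule LeastI_ex[where P = ?P])
  then show ?thesis using assms(4) unfolding mixing_time_def by (rule bspec)
qed

section \<open>The bottleneck bound\<close>

text \<open>A union bound: a trajectory that is outside \<open>S\<close> at time \<open>k\<close>
  has left \<open>S\<close> in an earlier step, and by \<open>exit\<close> the state just before
  that step was in \<open>B\<close>.\<close>

lemma prob_escape_le:
  assumes G: "finite (verts G)" "verts G \<noteq> {}" "0 < lam"
    and exit: "\<And>I J. I \<in> independent_sets G \<Longrightarrow> I \<in> S \<Longrightarrow> I \<notin> B \<Longrightarrow>
      J \<in> set_pmf (glauber_step G lam I) \<Longrightarrow> J \<in> S"
    and I: "I \<in> independent_sets G" "I \<in> S"
  shows "measure_pmf.prob (glauber_dist G lam I k) (- S) \<le>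
    (\<Sum>i<k. measure_pmf.prob (glauber_dist G lam I i) B)"
proof (induction k)
  case 0
  then show ?case using I by (simp add: glauber_dist_0)
next
  case (Suc k)
  let ?p = "glauber_dist G lam I k"
  have "measure_pmf.prob (glauber_dist G lam I (Suc k)) (- S) =
      measure_pmf.expectation ?p (\<lambda>J. measure_pmf.prob (glauber_step G lam J) (- S))"
    by (simp add: glauber_dist_Suc prob_bind_pmf)
  also have "\<dots> \<le> measure_pmf.expectation ?p (\<lambda>J. indicator (- S) J + indicator B J)"
  proof (rule expectation_mono_on)
    fix J assume "J \<in> set_pmf ?p"
    then have J: "J \<in> independent_sets G" using glauber_dist_independent[OF G I(1)] by blast
    show "measure_pmf.prob (glauber_step G lam J) (- S) \<le> indicator (- S) J + indicator B J"
    proof (cases "J \<in> S \<and> J \<notin> B")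
      case True
      then have "set_pmf (glauber_step G lam J) \<inter> - S = {}" using exit[OF J] by blast
      then have "measure_pmf.prob (glauber_step G lam J) (- S) = 0"
        by (simp only: measure_pmf_zero_iff)
      then show ?thesis by simp
    next
      case False
      then have "(1::real) \<le> indicator (- S) J + indicator B J" by (auto simp: indicator_def)
      then show ?thesis using measure_pmf.prob_le_1 order.trans by blast
    qed
  qed (rule integrable_prob,
      rule Bochner_Integration.integrable_add[OF integrable_indicator_pmf integrable_indicator_pmf])
  also have "\<dots> = measure_pmf.prob ?p (- S) + measure_pmf.prob ?p B"
    by (subst Bochner_Integration.integral_add) (simp_all add: integrable_indicator_pmf)
  finally show ?case using Suc by simp
qed

text \<open>From any start in \<open>S\<close> the law at the mixing time gives \<open>- S\<close>
  probability at least 1/2 - 1/4, although leaving \<open>S\<close> requires a visit to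
  \<open>B\<close>. A single start may be close to \<open>B\<close>, but on average over a
  stationary start each step visits \<open>B\<close> with exactly its stationary
  probability.\<close>

lemma bottleneck_mixing_time:
  assumes G: "finite (verts G)" "verts G \<noteq> {}" "0 < lam"
    and exit: "\<And>I J. I \<in> independent_sets G \<Longrightarrow> I \<in> S \<Longrightarrow> I \<notin> B \<Longrightarrow>
      J \<in> set_pmf (glauber_step G lam I) \<Longrightarrow> J \<in> S"
    and half: "measure_pmf.prob (hardcore_pmf G lam) S \<le> 1 / 2"
  shows "measure_pmf.prob (hardcore_pmf G lam) S \<le>
    4 * real (mixing_time G lam) * measure_pmf.prob (hardcore_pmf G lam) B"
proof -
  let ?p = "hardcore_pmf G lam" and ?k = "mixing_time G lam"
  let ?f = "\<lambda>I. \<Sum>i<?k. measure_pmf.prob (glauber_dist G lam I i) B"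
  have int: "integrable (measure_pmf ?p) (\<lambda>I. measure_pmf.prob (glauber_dist G lam I i) B)" for i
    by (rule integrable_prob)
  have stat: "measure_pmf.expectation ?p (\<lambda>I. measure_pmf.prob (glauber_dist G lam I i) B) =
      measure_pmf.prob ?p B" for i
    unfolding prob_bind_pmf[of ?p "\<lambda>I. glauber_dist G lam I i" B, symmetric]
      bind_glauber_dist_hardcore[OF G(1,3)] ..
  \<comment> \<open>Only the average over all starts is invariant, so on the right the starts
    outside \<open>S\<close> are kept; their terms are nonnegative.\<close>
  have "measure_pmf.expectation ?p (\<lambda>I. indicator S I * (1 / 4 :: real)) \<le> measure_pmf.expectation ?p ?f"
  proof (rule expectation_mono_on)
    fix I assume "I \<in> set_pmf ?p"
    then have I: "I \<in> independent_sets G" using set_pmf_hardcore[OF G(1,3)] by blast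
    show "indicator S I * (1 / 4 :: real) \<le> ?f I"
    proof (cases "I \<in> S")
      case True
      have "\<bar>measure_pmf.prob (glauber_dist G lam I ?k) (- S) - measure_pmf.prob ?p (- S)\<bar> \<le> 1 / 4"
        using tv_dist_mixing_time[OF G I] unfolding tv_dist_le_iff by blast
      moreover have "measure_pmf.prob ?p (- S) = 1 - measure_pmf.prob ?p S"
        using measure_pmf.prob_compl[of S ?p] unfolding Compl_eq_Diff_UNIV by simp
      ultimately have "1 / 4 \<le> measure_pmf.prob (glauber_dist G lam I ?k) (- S)"
        using half by linarith
      also have "\<dots> \<le> ?f I" by (rule prob_escape_le[OF G exit I True])
      finally show ?thesis using True by simp
    next
      case False
      then show ?thesis by (simp add: sum_nonneg)
    qed
  next
    show "integrable (measure_pmf ?p) ?f"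
      by (rule Bochner_Integration.integrable_sum) (rule int)
    show "integrable (measure_pmf ?p) (\<lambda>I. indicator S I * (1 / 4 :: real))"
      by (rule integrable_mult_left) (rule integrable_indicator_pmf)
  qed
  also have "measure_pmf.expectation ?p ?f =
      (\<Sum>i<?k. measure_pmf.expectation ?p (\<lambda>I. measure_pmf.prob (glauber_dist G lam I i) B))"
    by (rule Bochner_Integration.integral_sum) (rule int)
  also have "\<dots> = (\<Sum>i<?k. measure_pmf.prob ?p B)"
    by (rule sum.cong[OF refl]) (rule stat)
  finally show ?thesis by simp
qed

section \<open>Separators of the heap tree\<close>

lemma sum_heap_children:
  fixes g :: "nat \<Rightarrow> int"
  assumes "a \<le> b"
  shows "sum g {2 * a..<2 * b} = (\<Sum>y\<in>{a..<b}. g (2 * y) + g (2 * y + 1))"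
  using assms
proof (induction rule: dec_induct)
  case (step n)
  have "{2 * a..<2 * Suc n} = insert (2 * n + 1) (insert (2 * n) {2 * a..<2 * n})"
    using step by auto
  then show ?case using step by simp
qed simp

text \<open>A tree edge is named by its lower end \<open>x\<close>. Since
  \<open>0 div 2 = 0\<close>, the number 0 is never in the boundary.\<close>

definition heap_boundary :: "nat set \<Rightarrow> nat set" where
  "heap_boundary A = {x. (x \<in> A) \<noteq> (x div 2 \<in> A)}"

text \<open>If both children of every node copied its membership, the lower level would contain
  exactly twice as many elements of \<open>A\<close>. Each boundary edge changes this by
  one.\<close>

lemma heap_level_step:
  fixes A :: "nat set"
  assumes "a \<le> b"
  shows "\<bar>int (card (A \<inter> {2 * a..<2 * b})) - 2 * int (card (A \<inter> {a..<b}))\<bar>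
    \<le> int (card (heap_boundary A \<inter> {2 * a..<2 * b}))"
proof -
  let ?c = "\<lambda>x. of_bool (x \<in> A) :: int"
  have card: "int (card (B \<inter> {a..<b})) = (\<Sum>x\<in>{a..<b}. of_bool (x \<in> B))" for B :: "nat set" and a b
    by (simp add: Int_commute)
  have "2 * int (card (A \<inter> {a..<b})) = (\<Sum>x\<in>{2 * a..<2 * b}. ?c (x div 2))"
    unfolding card sum_heap_children[OF assms] by (simp add: sum_distrib_left)
  then have "\<bar>int (card (A \<inter> {2 * a..<2 * b})) - 2 * int (card (A \<inter> {a..<b}))\<bar>
      = \<bar>\<Sum>x\<in>{2 * a..<2 * b}. ?c x - ?c (x div 2)\<bar>"
    unfolding card by (simp only: sum_subtractf)
  also have "\<dots> \<le> (\<Sum>x\<in>{2 * a..<2 * b}. \<bar>?c x - ?c (x div 2)\<bar>)"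
    by (rule sum_abs)
  also have "\<dots> = (\<Sum>x\<in>{2 * a..<2 * b}. of_bool (x \<in> heap_boundary A))"
    by (rule sum.cong) (auto simp: heap_boundary_def)
  also have "\<dots> = int (card (heap_boundary A \<inter> {2 * a..<2 * b}))"
    unfolding card ..
  finally show ?thesis .
qed

lemma not_3_dvd_power_2: "\<not> (3::int) dvd 2 ^ n"
proof (induction n)
  case (Suc n)
  have "\<not> 3 dvd 2 * y" if "\<not> 3 dvd y" for y :: int using that by presburger
  from this[OF Suc] show ?case by simp
qed simp

text \<open>Multiplication by 3 gives \<open>3 * (f - 2^k * g) = 2^k * z - 1\<close> with
  \<open>z = 2^(h + 1 - k) - 3 * g\<close>, and \<open>z\<close> is nonzero because 3 divides no
  power of 2. So the right-hand side has absolute value at least \<open>2^k - 1\<close>, which is at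
  least half of \<open>2^k\<close>; this half and the factor 3 make the 6.\<close>

lemma third_far_from_multiples:
  fixes f g :: int
  assumes "3 * f + 1 = 2 ^ (h + 1)" "1 \<le> k" "k \<le> h"
  shows "2 ^ k \<le> 6 * \<bar>f - 2 ^ k * g\<bar>"
proof -
  define z where "z = 2 ^ (h + 1 - k) - 3 * g"
  have "(2::int) ^ (h + 1) = 2 ^ k * 2 ^ (h + 1 - k)"
    using assms(3) by (simp flip: power_add)
  then have 1: "3 * (f - 2 ^ k * g) = 2 ^ k * z - 1"
    using assms(1) by (simp add: z_def algebra_simps)
  have "z \<noteq> 0"
    using not_3_dvd_power_2[of "h + 1 - k"] by (auto simp: z_def)
  have p: "(2::int) \<le> 2 ^ k" using power_increasing[OF assms(2), of "2::int"] by simp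
  have "P \<le> 2 * \<bar>w - 1\<bar>" if "2 \<le> P" "P \<le> w \<or> w \<le> - P" for P w :: int
    using that by arith
  moreover have "2 ^ k \<le> 2 ^ k * z \<or> 2 ^ k * z \<le> - (2 ^ k)"
  proof (cases "0 < z")
    case True
    then show ?thesis by simp
  next
    case False
    then have "2 ^ k * z \<le> 2 ^ k * (- 1)" using \<open>z \<noteq> 0\<close> by (intro mult_left_mono) auto
    then show ?thesis by simp
  qed
  ultimately have "2 ^ k \<le> 2 * \<bar>2 ^ k * z - 1\<bar>" using p by blast
  also have "\<bar>2 ^ k * z - 1\<bar> = 3 * \<bar>f - 2 ^ k * g\<bar>"
    by (simp only: 1[symmetric] abs_mult abs_numeral)
  finally show ?thesis by simp
qed

text \<open>Passing from k to k + 1 halves the scaled error up to half of D k, while the scaled error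
  never falls below 1/6.\<close>

lemma doubling_error_ge:
  fixes F D :: "nat \<Rightarrow> int"
  assumes F0: "3 * F 0 + 1 = 2 ^ (h + 1)" and step: "\<And>k. k < h \<Longrightarrow> \<bar>F k - 2 * F (Suc k)\<bar> \<le> D k"
    and "k \<le> h"
  shows "real_of_int \<bar>F 0 - 2 ^ k * F k\<bar> / 2 ^ k + real k / 6 \<le> (\<Sum>i<k. real_of_int (D i))"
  using assms(3)
proof (induction k)
  case (Suc k)
  define x where "x = real_of_int \<bar>F 0 - 2 ^ k * F k\<bar> / 2 ^ k"
  define y where "y = real_of_int \<bar>F 0 - 2 ^ Suc k * F (Suc k)\<bar> / 2 ^ Suc k"
  have "F 0 - 2 ^ Suc k * F (Suc k) = (F 0 - 2 ^ k * F k) + 2 ^ k * (F k - 2 * F (Suc k))"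
    by (simp add: algebra_simps)
  then have "\<bar>F 0 - 2 ^ Suc k * F (Suc k)\<bar> \<le> \<bar>F 0 - 2 ^ k * F k\<bar> + \<bar>2 ^ k * (F k - 2 * F (Suc k))\<bar>"
    by linarith
  also have "\<bar>2 ^ k * (F k - 2 * F (Suc k))\<bar> \<le> 2 ^ k * D k"
    using step[of k] Suc.prems by (simp add: abs_mult)
  finally have "real_of_int \<bar>F 0 - 2 ^ Suc k * F (Suc k)\<bar> \<le>
      real_of_int (\<bar>F 0 - 2 ^ k * F k\<bar> + 2 ^ k * D k)"
    by (simp only: of_int_le_iff)
  also have "\<dots> = 2 ^ k * (x + real_of_int (D k))"
    by (simp add: x_def field_simps)
  finally have "2 * 2 ^ k * y \<le> 2 ^ k * (x + real_of_int (D k))"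
    by (simp add: y_def field_simps)
  then have 1: "2 * y \<le> x + real_of_int (D k)"
    by simp
  have "2 ^ Suc k \<le> 6 * \<bar>F 0 - 2 ^ Suc k * F (Suc k)\<bar>"
    by (rule third_far_from_multiples[OF F0]) (use Suc.prems in auto)
  then have "real_of_int (2 ^ Suc k) \<le> real_of_int (6 * \<bar>F 0 - 2 ^ Suc k * F (Suc k)\<bar>)"
    by (simp only: of_int_le_iff)
  then have 2: "1 / 6 \<le> y"
    by (simp add: y_def field_simps)
  have "x + real k / 6 \<le> (\<Sum>i<k. real_of_int (D i))"
    using Suc by (simp add: x_def)
  moreover have "y + real (Suc k) / 6 = y + 1 / 6 + real k / 6"
    by (simp add: add_divide_distrib)
  \<comment> \<open>\<open>y + 1/6 \<le> 2 * y \<le> x + D k\<close>: the error is halved, which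
    gives up at least 1/6, and \<open>D k\<close> pays for it.\<close>
  ultimately have "y + real (Suc k) / 6 \<le> (\<Sum>i<k. real_of_int (D i)) + real_of_int (D k)"
    using 1 2 by linarith
  then show ?case by (simp only: y_def sum.lessThan_Suc)
qed simp

lemma sum_card_heap_levels:
  assumes "k \<le> h"
  shows "(\<Sum>i<k. card (A \<inter> {2 ^ (h - i)..<2 ^ (h - i + 1)})) = card (A \<inter> {2 ^ (h - k + 1)..<(2::nat) ^ (h + 1)})"
  using assms
proof (induction k)
  case (Suc k)
  define l where "l = h - Suc k"
  have l: "h - k = l + 1" using Suc.prems by (simp add: l_def)
  have "(2::nat) ^ (l + 1) \<le> 2 ^ (l + 1 + 1)" "(2::nat) ^ (l + 1 + 1) \<le> 2 ^ (h + 1)"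
    using l by (intro power_increasing; simp)+
  then have "A \<inter> {2 ^ (l + 1)..<2 ^ (h + 1)} =
      (A \<inter> {2 ^ (l + 1 + 1)..<2 ^ (h + 1)}) \<union> (A \<inter> {2 ^ (l + 1)..<2 ^ (l + 1 + 1)})"
    using ivl_disj_un_two(3)[of "2 ^ (l + 1)" "2 ^ (l + 1 + 1)" "(2::nat) ^ (h + 1)"] by blast
  moreover have "(A \<inter> {2 ^ (l + 1 + 1)..<2 ^ (h + 1)}) \<inter> (A \<inter> {2 ^ (l + 1)..<2 ^ (l + 1 + 1)}) = {}"
    by auto
  ultimately have "card (A \<inter> {2 ^ (l + 1)..<2 ^ (h + 1)}) =
      card (A \<inter> {2 ^ (l + 1 + 1)..<2 ^ (h + 1)}) + card (A \<inter> {2 ^ (l + 1)..<2 ^ (l + 1 + 1)})"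
    by (simp add: card_Un_disjoint)
  then show ?case using Suc l unfolding l_def[symmetric] by simp
qed simp

text \<open>\<open>F k\<close> counts \<open>A\<close> on the level \<open>k\<close> steps above the
  leaves, so the errors of doubling are met on the way up. The levels below the root together are
  the numbers from 2 on; the root has no edge upwards.\<close>

lemma heap_boundary_ge:
  assumes "3 * card (A \<inter> {2 ^ h..<2 ^ (h + 1)}) + 1 = 2 ^ (h + 1)"
  shows "real h / 6 \<le> real (card (heap_boundary A \<inter> {2..<2 ^ (h + 1)}))"
proof -
  let ?F = "\<lambda>k. int (card (A \<inter> {2 ^ (h - k)..<2 ^ (h - k + 1)}))"
  let ?D = "\<lambda>k. int (card (heap_boundary A \<inter> {2 ^ (h - k)..<2 ^ (h - k + 1)}))"
  have 1: "real_of_int \<bar>?F 0 - 2 ^ h * ?F h\<bar> / 2 ^ h + real h / 6 \<le> (\<Sum>i<h. real_of_int (?D i))"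
  proof (rule doubling_error_ge)
    show "3 * ?F 0 + 1 = 2 ^ (h + 1)"
      using arg_cong[OF assms, of int] by simp
    show "\<bar>?F k - 2 * ?F (Suc k)\<bar> \<le> ?D k" if "k < h" for k
    proof -
      define l where "l = h - Suc k"
      have "h - k = Suc l" using that by (simp add: l_def)
      then show ?thesis
        using heap_level_step[of "2 ^ l" "2 ^ (l + 1)" A] unfolding l_def[symmetric] by simp
    qed
  qed simp
  have "0 \<le> real_of_int \<bar>?F 0 - 2 ^ h * ?F h\<bar> / 2 ^ h" by simp
  with 1 have "real h / 6 \<le> (\<Sum>i<h. real_of_int (?D i))" by linarith
  also have "\<dots> = real (\<Sum>i<h. card (heap_boundary A \<inter> {2 ^ (h - i)..<2 ^ (h - i + 1)}))"
    by simp
  finally show ?thesis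
    unfolding sum_card_heap_levels[OF order.refl] by simp
qed

text \<open>In heap numbering the root is 1 and the parent of x is x div 2. The parent 0 of the root is not a
  node, so conditions on x div 2 are vacuous at the root.\<close>

definition heap_nodes :: "nat \<Rightarrow> nat set" where
  "heap_nodes h = {1..<2 ^ (h + 1)}"

definition heap_leaves :: "nat \<Rightarrow> nat set" where
  "heap_leaves h = {2 ^ h..<2 ^ (h + 1)}"

definition separated_pairs :: "nat \<Rightarrow> (nat set \<times> nat set) set" where
  "separated_pairs h = {(A, B). A \<subseteq> heap_nodes h \<and> B \<subseteq> heap_nodes h \<and> A \<inter> B = {} \<and>
     (\<forall>x. \<not> (x \<in> A \<and> x div 2 \<in> B) \<and> \<not> (x \<in> B \<and> x div 2 \<in> A))}"

lemma finite_heap_nodes [simp]: "finite (heap_nodes h)"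
  by (simp add: heap_nodes_def)

lemma card_heap_nodes: "card (heap_nodes h) = 2 ^ (h + 1) - 1"
  by (simp add: heap_nodes_def)

lemma heap_parent: "x \<in> heap_nodes h \<Longrightarrow> x \<noteq> 1 \<Longrightarrow> x div 2 \<in> heap_nodes h"
  by (auto simp: heap_nodes_def)

lemma card_heap_children_le:
  fixes E :: "nat set"
  assumes "finite E"
  shows "finite {x. x div 2 \<in> E}" "card {x. x div 2 \<in> E} \<le> 2 * card E"
proof -
  have "{x. x div 2 \<in> E} \<subseteq> (\<lambda>e. 2 * e) ` E \<union> (\<lambda>e. 2 * e + 1) ` E"
  proof
    fix x assume "x \<in> {x. x div 2 \<in> E}"
    moreover have "x = 2 * (x div 2) \<or> x = 2 * (x div 2) + 1" by presburger
    ultimately show "x \<in> (\<lambda>e. 2 * e) ` E \<union> (\<lambda>e. 2 * e + 1) ` E" by blast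
  qed
  moreover have fin: "finite ((\<lambda>e. 2 * e) ` E \<union> (\<lambda>e. 2 * e + 1) ` E)" using assms by simp
  ultimately show "finite {x. x div 2 \<in> E}" by (rule finite_subset)
  have "card {x. x div 2 \<in> E} \<le> card ((\<lambda>e. 2 * e) ` E \<union> (\<lambda>e. 2 * e + 1) ` E)"
    by (rule card_mono[OF fin]) fact
  also have "\<dots> \<le> card ((\<lambda>e. 2 * e) ` E) + card ((\<lambda>e. 2 * e + 1) ` E)"
    by (rule card_Un_le)
  also have "\<dots> \<le> card E + card E"
    by (intro add_mono card_image_le assms)
  finally show "card {x. x div 2 \<in> E} \<le> 2 * card E" by simp
qed

text \<open>A tree edge with exactly one end in \<open>A\<close> cannot have the other in
  \<open>B\<close>, so that end is in the separator. A node is the end of at most three edges, one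
  upwards and two downwards; with the rate 1/6 per level this makes 18.\<close>

lemma separated_pairs_separator_ge:
  assumes AB: "(A, B) \<in> separated_pairs h" and f: "3 * card (A \<inter> heap_leaves h) + 1 = 2 ^ (h + 1)"
  shows "h \<le> 18 * card (heap_nodes h - A - B)"
proof -
  let ?E = "heap_nodes h - A - B"
  have 1: "real h / 6 \<le> real (card (heap_boundary A \<inter> {2..<2 ^ (h + 1)}))"
    using heap_boundary_ge f unfolding heap_leaves_def .
  have "heap_boundary A \<inter> {2..<2 ^ (h + 1)} \<subseteq> ?E \<union> {x. x div 2 \<in> ?E}"
  proof
    fix x assume x: "x \<in> heap_boundary A \<inter> {2..<2 ^ (h + 1)}"
    then have "x \<in> heap_nodes h" "x div 2 \<in> heap_nodes h"
      using heap_parent[of x h] by (auto simp: heap_nodes_def)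
    then show "x \<in> ?E \<union> {x. x div 2 \<in> ?E}"
      using x AB unfolding heap_boundary_def separated_pairs_def by blast
  qed
  then have "card (heap_boundary A \<inter> {2..<2 ^ (h + 1)}) \<le> card (?E \<union> {x. x div 2 \<in> ?E})"
    by (intro card_mono finite_UnI card_heap_children_le(1)) simp_all
  also have "\<dots> \<le> card ?E + 2 * card ?E"
    using card_Un_le[of ?E "{x. x div 2 \<in> ?E}"] card_heap_children_le(2)[of ?E] by simp
  finally have "card (heap_boundary A \<inter> {2..<2 ^ (h + 1)}) \<le> 3 * card ?E" by simp
  then have "real (card (heap_boundary A \<inter> {2..<2 ^ (h + 1)})) \<le> 3 * real (card ?E)"
    by (metis of_nat_le_iff of_nat_mult of_nat_numeral)
  with 1 have "real h \<le> 18 * real (card ?E)" by linarith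
  then show ?thesis by linarith
qed

section \<open>Total weight of separated pairs with a large separator\<close>

lemma sum_power_card_Pow:
  assumes "finite A"
  shows "(\<Sum>E\<in>Pow A. x ^ card E) = (1 + x :: 'b :: comm_semiring_1) ^ card A"
  using assms
proof (induction A rule: finite_induct)
  case (insert a A)
  have fin: "finite B" "a \<notin> B" if "B \<in> Pow A" for B
    using that insert by (auto intro: finite_subset)
  have inj: "inj_on (insert a) (Pow A)"
    using insert by (auto simp: inj_on_def)
  have "(\<Sum>E\<in>Pow (insert a A). x ^ card E) = (\<Sum>E\<in>Pow A. x ^ card E) + (\<Sum>E\<in>insert a ` Pow A. x ^ card E)"
    unfolding Pow_insert using insert by (intro sum.union_disjoint) auto
  also have "(\<Sum>E\<in>insert a ` Pow A. x ^ card E) = (\<Sum>E\<in>Pow A. x * x ^ card E)"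
    by (subst sum.reindex[OF inj]) (auto intro!: sum.cong simp: fin)
  finally show ?case
    using insert by (simp add: sum_distrib_left[symmetric] algebra_simps)
qed simp

text \<open>Outside the separator E a node inherits its side from its parent, so that a separated pair is
  determined by E together with the sides of the root and of the children of E.\<close>

lemma inj_on_separated_pairs:
  "inj_on (\<lambda>(A, B). (heap_nodes h - A - B, A \<inter> insert 1 {x. x div 2 \<in> heap_nodes h - A - B}))
    (separated_pairs h)"
proof (rule inj_onI, clarify)
  fix A B A' B'
  assume AB: "(A, B) \<in> separated_pairs h" and AB': "(A', B') \<in> separated_pairs h"
    and E: "heap_nodes h - A - B = heap_nodes h - A' - B'"
    and R: "A \<inter> insert 1 {x. x div 2 \<in> heap_nodes h - A - B} =
      A' \<inter> insert 1 {x. x div 2 \<in> heap_nodes h - A' - B'}"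
  have A: "x \<in> A \<longleftrightarrow> x \<in> A'" if "x \<in> heap_nodes h" for x
    using that
  proof (induction x rule: less_induct)
    case (less x)
    show ?case
    proof (cases "x = 1 \<or> x div 2 \<in> heap_nodes h - A - B")
      case True
      then show ?thesis using R E by blast
    next
      case False
      then have "x div 2 \<in> heap_nodes h" "x div 2 < x"
        using heap_parent less.prems by (auto simp: heap_nodes_def)
      then have "x div 2 \<in> A \<longleftrightarrow> x div 2 \<in> A'" "x div 2 \<in> heap_nodes h"
        using less.IH by blast+
      moreover have "x \<in> A \<Longrightarrow> x div 2 \<notin> B" "x \<in> B \<Longrightarrow> x div 2 \<notin> A"
        "x \<in> A' \<Longrightarrow> x div 2 \<notin> B'" "x \<in> B' \<Longrightarrow> x div 2 \<notin> A'"
        using AB AB' by (auto simp: separated_pairs_def)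
      moreover have "x div 2 \<in> A \<or> x div 2 \<in> B" "x div 2 \<in> A' \<or> x div 2 \<in> B'"
        using False \<open>x div 2 \<in> heap_nodes h\<close> E by blast+
      moreover have "x \<in> A \<or> x \<in> B \<longleftrightarrow> x \<in> A' \<or> x \<in> B'"
        using E less.prems by blast
      ultimately show ?thesis by blast
    qed
  qed
  have sub: "A \<subseteq> heap_nodes h" "B \<subseteq> heap_nodes h" "A \<inter> B = {}"
    "A' \<subseteq> heap_nodes h" "B' \<subseteq> heap_nodes h" "A' \<inter> B' = {}"
    using AB AB' by (auto simp: separated_pairs_def)
  have "A = A'" using A sub by blast
  moreover have "B = B'"
  proof -
    have "B = heap_nodes h - A - (heap_nodes h - A - B)" using sub by blast
    also have "\<dots> = heap_nodes h - A' - (heap_nodes h - A' - B')"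
      unfolding E unfolding \<open>A = A'\<close> ..
    also have "\<dots> = B'" using sub by blast
    finally show ?thesis .
  qed
  ultimately show "A = A' \<and> B = B'" ..
qed

lemma card_separated_pair:
  assumes "(A, B) \<in> separated_pairs h"
  shows "card A + card B = card (heap_nodes h) - card (heap_nodes h - A - B)"
proof -
  have sub: "A \<union> B \<subseteq> heap_nodes h" "A \<inter> B = {}"
    using assms by (auto simp: separated_pairs_def)
  then have fin: "finite A" "finite B" by (auto intro: finite_subset[OF _ finite_heap_nodes])
  have "heap_nodes h - A - B = heap_nodes h - (A \<union> B)" by blast
  then have "card (heap_nodes h - A - B) = card (heap_nodes h) - card (A \<union> B)"
    using sub fin by (simp add: card_Diff_subset)
  moreover have "card (A \<union> B) \<le> card (heap_nodes h)"
    using sub by (intro card_mono) auto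
  ultimately show ?thesis using card_Un_disjoint[OF fin sub(2)] by simp
qed

text \<open>Write \<open>M = 2^(h + 1)\<close> and \<open>N\<close> for the number of nodes. A
  separator \<open>E\<close> comes with at most \<open>2 * 4^card E\<close> choices of sides and
  weight \<open>L^(N - card E)\<close>, that is, with \<open>4 / L\<close> per missing node.
  Splitting this as \<open>4 * M / L\<close> times \<open>1 / M\<close>, the first factor is at most
  1 and may be lowered to the power \<open>j\<close>, while the second one pays for the sum over all
  \<open>E\<close>: by the binomial theorem that sum is \<open>(1 + 1 / M)^N\<close>, at most
  \<open>exp 1\<close> and so at most 3. The 6 is this 3 times the 2 for the side of the
  root.\<close>

lemma sum_separated_pairs_le:
  fixes L :: real
  assumes Q: "Q \<subseteq> separated_pairs h" and j: "\<And>A B. (A, B) \<in> Q \<Longrightarrow> j \<le> card (heap_nodes h - A - B)"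
    and L: "4 * 2 ^ (h + 1) \<le> L"
  shows "(\<Sum>(A, B)\<in>Q. L ^ (card A + card B)) \<le>
    6 * L ^ card (heap_nodes h) * (4 * 2 ^ (h + 1) / L) ^ j"
proof -
  let ?V = "heap_nodes h"
  let ?N = "card ?V"
  let ?M = "2 ^ (h + 1) :: real"
  let ?R = "\<lambda>E. insert 1 {x. x div 2 \<in> E}"
  let ?\<phi> = "\<lambda>(A, B). (?V - A - B, A \<inter> ?R (?V - A - B))"
  let ?S = "{E \<in> Pow ?V. j \<le> card E}"
  have L0: "0 < L" using L by (rule less_le_trans[rotated]) simp
  have finV: "finite E" if "E \<in> ?S" for E
    using that by (auto intro: finite_subset[OF _ finite_heap_nodes])
  have "(\<Sum>(A, B)\<in>Q. L ^ (card A + card B)) = (\<Sum>p\<in>Q. L ^ (?N - card (fst (?\<phi> p))))"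
    using Q by (intro sum.cong) (auto simp: card_separated_pair)
  also have "\<dots> = (\<Sum>z\<in>?\<phi> ` Q. L ^ (?N - card (fst z)))"
    using inj_on_subset[OF inj_on_separated_pairs Q] by (simp add: sum.reindex)
  also have "\<dots> \<le> (\<Sum>z\<in>Sigma ?S (\<lambda>E. Pow (?R E)). L ^ (?N - card (fst z)))"
  proof (rule sum_mono2)
    show "finite (Sigma ?S (\<lambda>E. Pow (?R E)))"
      using finV by (intro finite_SigmaI) (simp_all add: card_heap_children_le(1))
    show "?\<phi> ` Q \<subseteq> Sigma ?S (\<lambda>E. Pow (?R E))"
      using j by fastforce
  qed (use L0 in auto)
  also have "\<dots> = (\<Sum>E\<in>?S. \<Sum>_\<in>Pow (?R E). L ^ (?N - card E))"
    using finV by (subst sum.Sigma) (simp_all add: card_heap_children_le(1) split_beta)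
  also have "\<dots> \<le> (\<Sum>E\<in>?S. 2 * L ^ ?N * (4 * ?M / L) ^ j * (1 / ?M) ^ card E)"
  proof (rule sum_mono)
    fix E assume E: "E \<in> ?S"
    have fin: "finite {x. x div 2 \<in> E}" and le: "card {x. x div 2 \<in> E} \<le> 2 * card E"
      by (rule card_heap_children_le[OF finV[OF E]])+
    have "card (?R E) \<le> 1 + 2 * card E"
      using card_insert_le_m1 le by (simp add: card_insert_if fin)
    then have "real (2 ^ card (?R E)) \<le> 2 ^ (1 + 2 * card E)"
      by (simp only: of_nat_power of_nat_numeral) (rule power_increasing, auto)
    also have "\<dots> = 2 * 4 ^ card E" by (simp add: power_mult)
    finally have R: "real (card (Pow (?R E))) \<le> 2 * 4 ^ card E"
      using fin by (simp add: card_Pow)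
    have "card E \<le> ?N" using E by (auto intro: card_mono)
    then have "L ^ (?N - card E) = L ^ ?N / L ^ card E" using L0 by (simp add: power_diff)
    then have "(\<Sum>_\<in>Pow (?R E). L ^ (?N - card E)) = real (card (Pow (?R E))) * (L ^ ?N / L ^ card E)"
      by simp
    also have "\<dots> \<le> 2 * 4 ^ card E * (L ^ ?N / L ^ card E)"
      using R L0 by (intro mult_right_mono) auto
    also have "\<dots> = 2 * L ^ ?N * ((4 * ?M / L) ^ card E * (1 / ?M) ^ card E)"
    proof -
      have "(4 * ?M / L) ^ card E * (1 / ?M) ^ card E = (4 * ?M / L * (1 / ?M)) ^ card E"
        by (rule power_mult_distrib[symmetric])
      also have "4 * ?M / L * (1 / ?M) = 4 / L" by simp
      finally show ?thesis by (simp add: power_divide)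
    qed
    also have "\<dots> \<le> 2 * L ^ ?N * ((4 * ?M / L) ^ j * (1 / ?M) ^ card E)"
      using E L L0 by (intro mult_left_mono mult_right_mono power_decreasing) auto
    finally show "(\<Sum>_\<in>Pow (?R E). L ^ (?N - card E)) \<le>
        2 * L ^ ?N * (4 * ?M / L) ^ j * (1 / ?M) ^ card E"
      by (simp only: mult.assoc)
  qed
  also have "\<dots> \<le> (\<Sum>E\<in>Pow ?V. 2 * L ^ ?N * (4 * ?M / L) ^ j * (1 / ?M) ^ card E)"
    using L0 by (intro sum_mono2) auto
  also have "\<dots> = 2 * L ^ ?N * (4 * ?M / L) ^ j * (1 + 1 / ?M) ^ ?N"
    by (simp add: sum_distrib_left[symmetric] sum_power_card_Pow)
  also have "\<dots> \<le> 2 * L ^ ?N * (4 * ?M / L) ^ j * 3"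
  proof (intro mult_left_mono)
    have "(1 + 1 / ?M) ^ ?N \<le> exp (1 / ?M) ^ ?N"
      by (intro power_mono exp_ge_add_one_self) simp
    also have "\<dots> = exp (real ?N / ?M)" by (simp add: exp_of_nat_mult[symmetric])
    also have "real ?N \<le> ?M" by (simp add: card_heap_nodes of_nat_diff)
    then have "exp (real ?N / ?M) \<le> exp 1" by simp
    also have "\<dots> \<le> 3" by (rule exp_le)
    finally show "(1 + 1 / ?M) ^ ?N \<le> 3" .
  qed (use L0 in auto)
  finally show ?thesis by (simp add: algebra_simps)
qed

section \<open>Blow-ups of the heap tree\<close>

definition heap_near :: "nat \<Rightarrow> nat \<Rightarrow> bool" where
  "heap_near x y \<longleftrightarrow> x = y \<or> x = y div 2 \<or> y = x div 2"

definition heap_tree :: "nat \<Rightarrow> (nat, nat \<times> nat) pre_digraph" where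
  "heap_tree h = \<lparr>verts = heap_nodes h,
     arcs = {(x, y). x \<in> heap_nodes h \<and> y \<in> heap_nodes h \<and> x \<noteq> y \<and> heap_near x y},
     tail = fst, head = snd\<rparr>"

lemma simple_graph:
  fixes V :: "'a set"
  assumes "finite V" "\<And>u v. R u v \<Longrightarrow> R v u"
  defines "G \<equiv> \<lparr>verts = V, arcs = {(u, v). u \<in> V \<and> v \<in> V \<and> u \<noteq> v \<and> R u v}, tail = fst, head = snd\<rparr>"
  shows "graph G" "arcs_ends G = {(u, v). u \<in> V \<and> v \<in> V \<and> u \<noteq> v \<and> R u v}"
proof -
  show ends: "arcs_ends G = {(u, v). u \<in> V \<and> v \<in> V \<and> u \<noteq> v \<and> R u v}"
    by (simp add: arcs_ends_conv G_def)
  have "finite {(u, v). u \<in> V \<and> v \<in> V \<and> u \<noteq> v \<and> R u v}"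
    by (rule finite_subset[of _ "V \<times> V"]) (use assms(1) in auto)
  then show "graph G"
    by unfold_locales
      (use assms(1,2) in \<open>auto simp: G_def arc_to_ends_def symmetric_def arcs_ends_conv intro!: symI\<close>)
qed

lemma heap_near_sym: "heap_near x y \<Longrightarrow> heap_near y x"
  by (auto simp: heap_near_def)

lemma graph_heap_tree: "graph (heap_tree h)"
  and arcs_ends_heap_tree: "arcs_ends (heap_tree h) =
    {(x, y). x \<in> heap_nodes h \<and> y \<in> heap_nodes h \<and> x \<noteq> y \<and> heap_near x y}"
  using simple_graph[of "heap_nodes h" heap_near] heap_near_sym
  by (simp_all add: heap_tree_def)

lemma verts_heap_tree: "verts (heap_tree h) = heap_nodes h"
  by (simp add: heap_tree_def)

lemma induce_subgraph_verts_id: "wf_digraph G \<Longrightarrow> G \<restriction> verts G = G"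
  by (rule pre_digraph.equality) (auto simp: wf_digraph_def)

lemma (in graph) connected_iff_connected_on:
  "Digraph_Component.connected G \<longleftrightarrow> connected_on (arcs_ends G) (verts G)"
  using connected_induce_subgraph_iff[of "verts G"] induce_subgraph_verts_id[OF wf_digraph] by simp

lemma connected_on_hub:
  assumes "c \<in> C" "sym R" "\<And>x. x \<in> C \<Longrightarrow> (x, c) \<in> (R \<inter> C \<times> C)\<^sup>*"
  shows "connected_on R C"
  unfolding connected_on_def
proof (intro conjI ballI)
  have "sym ((R \<inter> C \<times> C)\<^sup>*)" using assms(2) by (intro sym_rtrancl) (auto simp: sym_def)
  then show "(x, y) \<in> (R \<inter> C \<times> C)\<^sup>*" if "x \<in> C" "y \<in> C" for x y
    using assms(3)[OF that(1)] assms(3)[OF that(2)] by (meson rtrancl_trans symD)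
qed (use assms in auto)

lemma one_in_heap_nodes: "1 \<in> heap_nodes h"
proof -
  have "(1::nat) < 2 ^ (h + 1)" by (rule one_less_power) auto
  then show ?thesis by (simp add: heap_nodes_def)
qed

lemma connected_heap_tree: "Digraph_Component.connected (heap_tree h)"
proof -
  interpret graph "heap_tree h" by (rule graph_heap_tree)
  let ?R = "arcs_ends (heap_tree h) \<inter> heap_nodes h \<times> heap_nodes h"
  have "(x, 1) \<in> ?R\<^sup>*" if "x \<in> heap_nodes h" for x
    using that
  proof (induction x rule: less_induct)
    case (less x)
    show ?case
    proof (cases "x = 1")
      case False
      then have p: "x div 2 \<in> heap_nodes h" "x div 2 < x"
        using heap_parent less.prems by (auto simp: heap_nodes_def)
      then have "(x, x div 2) \<in> ?R"
        using less.prems by (simp add: arcs_ends_heap_tree heap_near_def)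
      moreover have "(x div 2, 1) \<in> ?R\<^sup>*" by (rule less.IH) (use p in auto)
      ultimately show ?thesis by (rule converse_rtrancl_into_rtrancl)
    qed simp
  qed
  then have "connected_on (arcs_ends (heap_tree h)) (heap_nodes h)"
    by (rule connected_on_hub[OF one_in_heap_nodes sym_arcs_ends])
  then show ?thesis unfolding connected_iff_connected_on by (simp add: verts_heap_tree)
qed

text \<open>Both neighbours on a cycle of a node of maximal number are its parent.\<close>

lemma heap_tree_no_cycle:
  assumes "pre_digraph.cycle (heap_tree h) p"
  shows "length p < 3"
proof (rule ccontr)
  interpret graph "heap_tree h" by (rule graph_heap_tree)
  let ?T = "heap_tree h" and ?n = "length p"
  assume "\<not> ?n < 3"
  then have n3: "3 \<le> ?n" and n0: "0 < ?n" by linarith+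
  then have "p \<noteq> []" by auto
  obtain u where u: "awalk u p u" "distinct (tl (awalk_verts u p))"
    using assms by (auto simp: cycle_def)
  have cas: "cas u p u" using u by auto
  then have dist: "distinct (map (head ?T) p)"
    using u(2) n3 by (auto simp: awalk_verts_conv'[OF cas] split: if_splits)
  have chain: "cas a q b \<Longrightarrow> (\<forall>i. Suc i < length q \<longrightarrow> tail ?T (q ! Suc i) = head ?T (q ! i)) \<and>
      (q \<noteq> [] \<longrightarrow> tail ?T (q ! 0) = a \<and> head ?T (last q) = b)" for a q b
  proof (induction q arbitrary: a)
    case (Cons e q)
    then have IH: "(\<forall>i. Suc i < length q \<longrightarrow> tail ?T (q ! Suc i) = head ?T (q ! i)) \<and>
        (q \<noteq> [] \<longrightarrow> tail ?T (q ! 0) = head ?T e \<and> head ?T (last q) = b)"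
      using Cons.IH[of "head ?T e"] Cons.prems by simp
    have "tail ?T ((e # q) ! Suc i) = head ?T ((e # q) ! i)" if "Suc i < length (e # q)" for i
      using IH that by (cases i) auto
    then show ?case using IH Cons.prems by auto
  qed simp
  \<comment> \<open>Periodic indexing gives the node of maximal number both a predecessor and a
    successor on the cycle.\<close>
  define x where "x i = head ?T (p ! (i mod ?n))" for i
  have next_arc: "p ! (Suc i mod ?n) \<in> arcs ?T \<and> tail ?T (p ! (Suc i mod ?n)) = x i" for i
  proof -
    have "Suc i mod ?n < ?n" by (rule mod_less_divisor[OF n0])
    then have "p ! (Suc i mod ?n) \<in> arcs ?T" using u(1) by (meson awalkE nth_mem subsetD)
    moreover have "tail ?T (p ! (Suc i mod ?n)) = x i"
    proof (cases "Suc (i mod ?n) = ?n")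
      case True
      then have "Suc i mod ?n = 0" by (simp add: mod_Suc)
      moreover have "i mod ?n = ?n - 1" using True by simp
      then have "x i = head ?T (last p)" using \<open>p \<noteq> []\<close> by (simp add: x_def last_conv_nth)
      ultimately show ?thesis using chain[OF cas] \<open>p \<noteq> []\<close> by simp
    next
      case False
      then have "Suc i mod ?n = Suc (i mod ?n)" by (simp add: mod_Suc)
      moreover have "Suc (i mod ?n) < ?n" using False mod_less_divisor[OF n0, of i] by linarith
      ultimately show ?thesis using chain[OF cas] by (simp add: x_def)
    qed
    ultimately show ?thesis ..
  qed
  have adj: "(x i, x (Suc i)) \<in> arcs_ends ?T" for i
    using next_arc[of i] in_arcs_imp_in_arcs_ends x_def by metis
  have inj: "i mod ?n = j mod ?n" if "x i = x j" for i j
  proof -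
    have "i mod ?n < ?n" "j mod ?n < ?n" by (rule mod_less_divisor[OF n0])+
    then show ?thesis using dist that by (simp add: x_def distinct_conv_nth) metis
  qed
  have "range (\<lambda>i. i mod ?n) \<subseteq> {..<?n}" using mod_less_divisor[OF n0] by blast
  then have "finite (range (\<lambda>i. i mod ?n))" by (rule finite_subset) simp
  moreover have "range x = (\<lambda>i. head ?T (p ! i)) ` range (\<lambda>i. i mod ?n)"
    by (simp add: x_def image_image)
  ultimately have "finite (range x)" by simp
  have "Max (range x) \<in> range x" using \<open>finite (range x)\<close> by (intro Max_in) auto
  then obtain k where k: "x k = Max (range x)" by (metis imageE)
  have max: "x i \<le> x k" for i unfolding k using \<open>finite (range x)\<close> by simp
  \<comment> \<open>After a full turn \<open>?k - 1\<close> is a genuine predecessor even if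
    \<open>k = 0\<close>.\<close>
  let ?k = "k + ?n"
  have xk: "x ?k = x k" by (simp add: x_def)
  have pre: "Suc (?k - 1) = ?k" using n3 by simp
  have "x (Suc ?k) = x k div 2"
    using adj[of ?k] max[of "Suc ?k"] unfolding xk arcs_ends_heap_tree heap_near_def
    by (auto simp: heap_nodes_def)
  moreover have "x (?k - 1) = x k div 2"
    using adj[of "?k - 1"] max[of "?k - 1"] unfolding pre xk arcs_ends_heap_tree heap_near_def
    by (auto simp: heap_nodes_def)
  \<comment> \<open>Positions at distance 2 carry the same node, so the length of the cycle divides
    2.\<close>
  ultimately have "Suc ?k mod ?n = (?k - 1) mod ?n" by (metis inj)
  then have "?n dvd Suc ?k - (?k - 1)" by (intro mod_eq_dvd_iff_nat[THEN iffD1]) auto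
  then have "?n dvd 2" using n3 by simp
  then show False using n3 by (auto dest: dvd_imp_le)
qed

lemma is_tree_heap_tree: "is_tree (heap_tree h)"
  unfolding is_tree_def
  using graph_heap_tree connected_heap_tree heap_tree_no_cycle by (metis not_le)

text \<open>The clique with number b consists of the vertices v with v div m = b and belongs to the node
  b div (2 t); the upper t of the 2 t cliques of a node form its side True.\<close>

locale clique_blowup =
  fixes t m h :: nat
  assumes t_pos: "0 < t" and m_pos: "0 < m" and h_pos: "1 \<le> h"
begin

definition node :: "nat \<Rightarrow> nat" where "node v = v div m div (2 * t)"

definition side :: "nat \<Rightarrow> bool" where "side v \<longleftrightarrow> t \<le> v div m mod (2 * t)"

definition V :: "nat set" where "V = {v. node v \<in> heap_nodes h}"

definition adj :: "nat \<Rightarrow> nat \<Rightarrow> bool" where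
  "adj u v \<longleftrightarrow> u div m = v div m \<or> side u \<noteq> side v \<and> heap_near (node u) (node v)"

definition G :: "(nat, nat \<times> nat) pre_digraph" where
  "G = \<lparr>verts = V, arcs = {(u, v). u \<in> V \<and> v \<in> V \<and> u \<noteq> v \<and> adj u v}, tail = fst, head = snd\<rparr>"

definition blocks :: "nat \<Rightarrow> bool \<Rightarrow> nat set" where
  "blocks x s = {b. b div (2 * t) = x \<and> (t \<le> b mod (2 * t)) = s}"

lemma V_eq: "V = {m * (2 * t)..<2 ^ (h + 1) * (m * (2 * t))}"
proof -
  let ?k = "m * (2 * t)"
  have "0 < ?k" using t_pos m_pos by simp
  then have "1 \<le> v div ?k \<and> v div ?k < 2 ^ (h + 1) \<longleftrightarrow> v \<in> {?k..<2 ^ (h + 1) * ?k}" for v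
    by (simp only: atLeastLessThan_iff less_eq_div_iff_mult_less_eq div_less_iff_less_mult mult_1)
  moreover have "V = {v. 1 \<le> v div ?k \<and> v div ?k < 2 ^ (h + 1)}"
    unfolding V_def node_def heap_nodes_def div_mult2_eq atLeastLessThan_iff ..
  ultimately show ?thesis by blast
qed

lemma finite_V: "finite V"
  by (simp add: V_eq)

lemma card_V: "card V = (2 ^ (h + 1) - 1) * (m * (2 * t))"
  by (simp add: V_eq diff_mult_distrib)

lemma verts_G: "verts G = V"
  by (simp add: G_def)

lemma adj_sym: "adj u v \<Longrightarrow> adj v u"
  by (auto simp: adj_def dest: heap_near_sym)

lemma graph_G: "graph G"
  and arcs_ends_G: "arcs_ends G = {(u, v). u \<in> V \<and> v \<in> V \<and> u \<noteq> v \<and> adj u v}"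
  unfolding G_def by (rule simple_graph[OF finite_V adj_sym], assumption)+

lemma independent_iff:
  "I \<in> independent_sets G \<longleftrightarrow> I \<subseteq> V \<and> (\<forall>u\<in>I. \<forall>v\<in>I. u \<noteq> v \<longrightarrow> \<not> adj u v)"
  by (auto simp: independent_sets_def arcs_ends_G verts_G)

lemma independent_inj_on_block: "I \<in> independent_sets G \<Longrightarrow> inj_on (\<lambda>v. v div m) I"
  unfolding independent_iff adj_def inj_on_def by blast

lemma div_m_in_blocks: "v div m \<in> blocks x s \<longleftrightarrow> node v = x \<and> side v = s"
  by (simp add: blocks_def node_def side_def)

lemma blocks_eq: "blocks x s = (if s then {x * (2 * t) + t..<x * (2 * t) + 2 * t} else {x * (2 * t)..<x * (2 * t) + t})"
proof (rule set_eqI)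
  fix b
  have pos: "0 < 2 * t" using t_pos by simp
  have "b = b div (2 * t) * (2 * t) + b mod (2 * t)" "b mod (2 * t) < 2 * t"
    by (rule div_mult_mod_eq[symmetric], rule mod_less_divisor[OF pos])
  then have "b \<in> blocks x s \<Longrightarrow> b \<in> (if s then {x * (2 * t) + t..<x * (2 * t) + 2 * t} else {x * (2 * t)..<x * (2 * t) + t})"
    unfolding blocks_def by (cases s) auto
  moreover have "b \<in> blocks x s" if b: "b \<in> (if s then {x * (2 * t) + t..<x * (2 * t) + 2 * t} else {x * (2 * t)..<x * (2 * t) + t})"
  proof -
    define r where "r = b - x * (2 * t)"
    have r: "b = r + x * (2 * t)" "r < 2 * t" "t \<le> r \<longleftrightarrow> s"
      using b by (auto simp: r_def split: if_splits)
    then have "b div (2 * t) = x" "b mod (2 * t) = r"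
      by simp_all
    then show ?thesis using r(3) by (simp add: blocks_def)
  qed
  ultimately show "b \<in> blocks x s \<longleftrightarrow> b \<in> (if s then {x * (2 * t) + t..<x * (2 * t) + 2 * t} else {x * (2 * t)..<x * (2 * t) + t})"
    by blast
qed

lemma finite_blocks: "finite (blocks x s)" and card_blocks: "card (blocks x s) = t"
  by (simp_all add: blocks_eq)

lemma blocks_disjoint: "x \<noteq> y \<Longrightarrow> blocks x s \<inter> blocks y s' = {}"
  by (auto simp: blocks_def)

text \<open>A bag belongs to the tree edge above \<open>x\<close>. The bag of the root involves the
  root only, since no vertex in \<open>V\<close> has node 0.\<close>

definition bag :: "nat \<Rightarrow> nat set" where
  "bag x = {v \<in> V. node v = x \<or> node v = x div 2}"

text \<open>The nodes whose bags contain \<open>v\<close> are \<open>node v\<close> and its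
  children, a star around \<open>node v\<close>.\<close>

lemma tree_decomposition_G: "tree_decomposition G (heap_tree h) bag"
  unfolding tree_decomposition_def verts_heap_tree verts_G
proof (intro conjI ballI allI impI)
  interpret T: graph "heap_tree h" by (rule graph_heap_tree)
  show "is_tree (heap_tree h)" by (rule is_tree_heap_tree)
  show "bag s \<subseteq> V" for s by (auto simp: bag_def)
  show "\<exists>s\<in>heap_nodes h. v \<in> bag s" if "v \<in> V" for v
    using that by (auto simp: bag_def V_def)
  show "\<exists>s\<in>heap_nodes h. u \<in> bag s \<and> v \<in> bag s" if "u \<rightarrow>\<^bsub>G\<^esub> v" for u v
  proof -
    have uv: "u \<in> V" "v \<in> V" "adj u v" using that by (auto simp: arcs_ends_G)
    then have "heap_near (node u) (node v)" by (auto simp: adj_def heap_near_def node_def)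
    then consider "node u = node v" | "node u = node v div 2" | "node v = node u div 2"
      by (auto simp: heap_near_def)
    then show ?thesis using uv by cases (auto simp: bag_def V_def)
  qed
  show "Digraph_Component.connected (heap_tree h \<restriction> {s \<in> heap_nodes h. v \<in> bag s})" if v: "v \<in> V" for v
    unfolding T.connected_induce_subgraph_iff
  proof (rule connected_on_hub)
    let ?C = "{s \<in> heap_nodes h. v \<in> bag s}"
    show c: "node v \<in> ?C" using v by (auto simp: bag_def V_def)
    show "sym (arcs_ends (heap_tree h))" by (rule T.sym_arcs_ends)
    show "(x, node v) \<in> (arcs_ends (heap_tree h) \<inter> ?C \<times> ?C)\<^sup>*" if x: "x \<in> ?C" for x
    proof (cases "x = node v")
      case False
      then have "node v = x div 2" using x by (auto simp: bag_def)
      then have "(x, node v) \<in> arcs_ends (heap_tree h)"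
        using x c False by (simp add: arcs_ends_heap_tree heap_near_def)
      then show ?thesis using x c by blast
    qed simp
  qed
qed

text \<open>The nodes of a bag are equal or adjacent, so opposite sides are completely joined and an
  independent set keeps to one side. It takes at most one vertex from each of the at most
  \<open>2 * t\<close> cliques there.\<close>

lemma card_independent_in_bag:
  assumes I: "I \<in> independent_sets G" "I \<subseteq> bag x"
  shows "card I \<le> 2 * t"
proof (cases "I = {}")
  case False
  then obtain u where u: "u \<in> I" by auto
  have nd: "node v = x \<or> node v = x div 2" if "v \<in> I" for v
    using that I(2) by (auto simp: bag_def)
  have sd: "side v = side u" if "v \<in> I" for v
  proof (rule ccontr)
    assume "side v \<noteq> side u"
    moreover have "heap_near (node v) (node u)"
      using nd[OF that] nd[OF u] by (auto simp: heap_near_def)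
    ultimately have "adj v u" "v \<noteq> u" by (auto simp: adj_def)
    then show False using I(1) that u by (auto simp: independent_iff)
  qed
  then have "(\<lambda>v. v div m) ` I \<subseteq> blocks x (side u) \<union> blocks (x div 2) (side u)"
    using I(2) by (auto simp: div_m_in_blocks bag_def)
  then have "card ((\<lambda>v. v div m) ` I) \<le> card (blocks x (side u) \<union> blocks (x div 2) (side u))"
    by (intro card_mono) (auto simp: finite_blocks)
  also have "\<dots> \<le> 2 * t"
    using card_Un_le[of "blocks x (side u)" "blocks (x div 2) (side u)"] by (simp add: card_blocks)
  finally show ?thesis
    by (simp add: card_image[OF independent_inj_on_block[OF I(1)]])
qed simp

lemma two_in_heap_nodes: "2 \<in> heap_nodes h"
proof -
  have "(2::nat) ^ 2 \<le> 2 ^ (h + 1)" using h_pos by (intro power_increasing) auto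
  then show ?thesis by (simp add: heap_nodes_def)
qed

lemma tree_alpha_G: "tree_alpha G = 2 * t"
proof (rule tree_alpha_eqI[OF tree_decomposition_G])
  \<comment> \<open>One vertex of each clique, the smallest, on side \<open>s\<close> of the nodes 1
    and 2. The node 2 exists because \<open>h\<close> is positive.\<close>
  let ?A = "\<lambda>s. (\<lambda>b. b * m) ` (blocks 1 s \<union> blocks 2 s)"
  show "finite (verts G)" by (simp add: verts_G finite_V)
  show "card I \<le> 2 * t" if "I \<in> independent_sets G" "I \<subseteq> bag s" for s I
    using that by (rule card_independent_in_bag)
  have div: "b * m div m = b" for b using m_pos by simp
  have mem: "v \<in> V \<and> (node v = 1 \<or> node v = 2) \<and> side v = s \<and> v = v div m * m" if v: "v \<in> ?A s" for v s
  proof -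
    obtain b where b: "v = b * m" "b \<in> blocks 1 s \<union> blocks 2 s" using v by blast
    then have "v div m \<in> blocks 1 s \<union> blocks 2 s" by (simp add: div)
    then have "(node v = 1 \<or> node v = 2) \<and> side v = s" unfolding Un_iff div_m_in_blocks by blast
    moreover from this have "v \<in> V"
      using one_in_heap_nodes two_in_heap_nodes by (auto simp: V_def)
    ultimately show ?thesis using b(1) by (simp add: div)
  qed
  have "?A s \<in> independent_sets G" for s
    unfolding independent_iff
  proof (intro conjI ballI impI)
    show "?A s \<subseteq> V" using mem by blast
    fix u v assume "u \<in> ?A s" "v \<in> ?A s" "u \<noteq> v"
    then show "\<not> adj u v" using mem[of u s] mem[of v s] unfolding adj_def by metis
  qed
  then show "?A False \<in> independent_sets G" "?A True \<in> independent_sets G" by blast+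
  have "card (?A s) = 2 * t" for s
  proof -
    have "card (?A s) = card (blocks 1 s \<union> blocks 2 s)"
      using m_pos by (intro card_image) (auto simp: inj_on_def)
    also have "\<dots> = 2 * t"
      by (subst card_Un_disjoint) (simp_all add: finite_blocks card_blocks blocks_disjoint)
    finally show ?thesis .
  qed
  then show "card (?A False) = 2 * t" "card (?A True) = 2 * t" by blast+
  fix a b assume "a \<in> ?A False" "b \<in> ?A True"
  then have ab: "a \<in> V" "b \<in> V" "\<not> side a" "side b" "node a = 1 \<or> node a = 2" "node b = 1 \<or> node b = 2"
    using mem[of a False] mem[of b True] by simp_all
  then have "adj a b" by (auto simp: adj_def heap_near_def)
  moreover have "a \<noteq> b" using ab by blast
  ultimately show "a \<rightarrow>\<^bsub>G\<^esub> b \<and> b \<rightarrow>\<^bsub>G\<^esub> a"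
    using ab adj_sym by (auto simp: arcs_ends_G)
qed

end

section \<open>Weights of independent sets\<close>

text \<open>A set \<open>I\<close> in the union of the pieces amounts to an independent choice of
  its traces on them, and cardinalities add up, so the generating function factorises.\<close>

lemma sum_disjoint_families:
  fixes x :: "'b :: comm_semiring_1"
  assumes "finite A" "disjoint_family_on W A" "\<And>j. j \<in> A \<Longrightarrow> finite (W j)" "\<And>j. j \<in> A \<Longrightarrow> F j \<subseteq> Pow (W j)"
  shows "(\<Sum>I\<in>{I. I \<subseteq> (\<Union>j\<in>A. W j) \<and> (\<forall>j\<in>A. I \<inter> W j \<in> F j)}. x ^ card I) =
    (\<Prod>j\<in>A. \<Sum>J\<in>F j. x ^ card J)"
  using assms
proof (induction A rule: finite_induct)
  case (insert a A)
  let ?U = "\<Union>j\<in>A. W j"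
  let ?fam = "{I. I \<subseteq> ?U \<and> (\<forall>j\<in>A. I \<inter> W j \<in> F j)}"
  let ?fam' = "{I. I \<subseteq> (\<Union>j\<in>insert a A. W j) \<and> (\<forall>j\<in>insert a A. I \<inter> W j \<in> F j)}"
  have Wa: "W a \<inter> W j = {}" if "j \<in> A" for j
    using insert.prems(1) insert.hyps(2) that unfolding disjoint_family_on_def by (metis insertCI)
  have Fa: "J \<subseteq> W a" if "J \<in> F a" for J using that insert.prems(3)[of a] by auto
  have fin: "finite (W a)" "finite ?U" using insert by auto
  have IH: "(\<Sum>I\<in>?fam. x ^ card I) = (\<Prod>j\<in>A. \<Sum>J\<in>F j. x ^ card J)"
    by (rule insert.IH) (use insert.prems in \<open>auto simp: disjoint_family_on_def\<close>)
  have "(\<Sum>I\<in>?fam'. x ^ card I) = (\<Sum>(J, K)\<in>F a \<times> ?fam. x ^ card J * x ^ card K)"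
  proof (rule sum.reindex_bij_witness[where i = "\<lambda>(J, K). J \<union> K" and j = "\<lambda>I. (I \<inter> W a, I \<inter> ?U)"])
    fix I assume I: "I \<in> ?fam'"
    show "(case (I \<inter> W a, I \<inter> ?U) of (J, K) \<Rightarrow> J \<union> K) = I"
      using I by auto
    have "I \<inter> ?U \<inter> W j = I \<inter> W j" if "j \<in> A" for j using that by auto
    then show "(I \<inter> W a, I \<inter> ?U) \<in> F a \<times> ?fam" using I by auto
    have "card (I \<inter> W a \<union> I \<inter> ?U) = card (I \<inter> W a) + card (I \<inter> ?U)"
      using fin Wa by (intro card_Un_disjoint) auto
    moreover have "I \<inter> W a \<union> I \<inter> ?U = I" using I by auto
    ultimately have "card I = card (I \<inter> W a) + card (I \<inter> ?U)" by metis
    then show "(case (I \<inter> W a, I \<inter> ?U) of (J, K) \<Rightarrow> x ^ card J * x ^ card K) = x ^ card I"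
      by (simp add: power_add)
  next
    fix p assume "p \<in> F a \<times> ?fam"
    then obtain J K where p: "p = (J, K)" "J \<in> F a" "K \<in> ?fam" by auto
    have J: "J \<subseteq> W a" and K: "K \<subseteq> ?U" using p Fa by auto
    have "(J \<union> K) \<inter> W a = J" "(J \<union> K) \<inter> ?U = K"
      using J K Wa by blast+
    then show "((case p of (J, K) \<Rightarrow> J \<union> K) \<inter> W a, (case p of (J, K) \<Rightarrow> J \<union> K) \<inter> ?U) = p"
      by (simp add: p)
    have "(J \<union> K) \<inter> W j = K \<inter> W j" if "j \<in> A" for j
      using J Wa[OF that] by blast
    then show "(case p of (J, K) \<Rightarrow> J \<union> K) \<in> ?fam'"
      using p J K \<open>(J \<union> K) \<inter> W a = J\<close> by auto
  qed
  also have "\<dots> = (\<Sum>J\<in>F a. x ^ card J) * (\<Sum>I\<in>?fam. x ^ card I)"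
    by (simp add: sum_product sum.cartesian_product)
  finally show ?case unfolding IH prod.insert[OF insert.hyps] .
qed simp

context clique_blowup
begin

definition cell :: "nat \<Rightarrow> bool \<Rightarrow> nat set" where
  "cell x s = {v. node v = x \<and> side v = s}"

text \<open>The traces that an independent set can leave on a cell it occupies: at most one vertex
  per clique, but not empty.\<close>

definition transversals :: "nat \<times> bool \<Rightarrow> nat set set" where
  "transversals c = {J. J \<subseteq> cell (fst c) (snd c) \<and> J \<noteq> {} \<and> inj_on (\<lambda>v. v div m) J}"

text \<open>The partition function of an occupied cell: each of its \<open>t\<close> cliques is
  empty or contributes one of \<open>m\<close> vertices, and the term 1 of the empty choice is
  removed.\<close>

definition node_weight :: "real \<Rightarrow> real" where
  "node_weight lam = (1 + real m * lam) ^ t - 1"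

lemma block_eq: "{v. v div m = b} = {b * m..<b * m + m}"
proof -
  have "v div m = b \<longleftrightarrow> b * m \<le> v \<and> v < Suc b * m" for v
  proof -
    have "v div m = b \<longleftrightarrow> b \<le> v div m \<and> v div m < Suc b" by linarith
    then show ?thesis
      by (simp only: less_eq_div_iff_mult_less_eq[OF m_pos] div_less_iff_less_mult[OF m_pos])
  qed
  then show ?thesis by (simp add: set_eq_iff add.commute)
qed

lemma sum_transversals:
  assumes "0 < lam"
  shows "(\<Sum>J\<in>transversals (x, s). lam ^ card J) = node_weight lam"
proof -
  let ?W = "\<lambda>b. {v. v div m = b}"
  let ?F = "\<lambda>b. insert {} ((\<lambda>v. {v}) ` ?W b)"
  let ?T = "{J. J \<subseteq> cell x s \<and> inj_on (\<lambda>v. v div m) J}"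
  have cell: "cell x s = (\<Union>b\<in>blocks x s. ?W b)"
    by (auto simp: cell_def div_m_in_blocks)
  have finW: "finite (?W b)" and cardW: "card (?W b) = m" for b
    by (simp_all add: block_eq)
  have F: "J \<inter> ?W b \<in> ?F b" if "inj_on (\<lambda>v. v div m) J" for J b
  proof (cases "J \<inter> ?W b = {}")
    case False
    then obtain u where u: "u \<in> J" "u div m = b" by auto
    have "J \<inter> ?W b \<subseteq> {u}"
    proof
      fix v assume "v \<in> J \<inter> ?W b"
      then show "v \<in> {u}" using inj_onD[OF that, of v u] u by simp
    qed
    then have "J \<inter> ?W b = {u}" using u by blast
    then show ?thesis using u by simp
  qed auto
  have inj: "inj_on (\<lambda>v. v div m) J" if J: "J \<subseteq> cell x s" "\<forall>b\<in>blocks x s. J \<inter> ?W b \<in> ?F b" for J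
  proof (rule inj_onI)
    fix u v assume uv: "u \<in> J" "v \<in> J" "u div m = v div m"
    then have "u div m \<in> blocks x s" using J(1) by (auto simp: cell_def div_m_in_blocks)
    then have "J \<inter> ?W (u div m) \<in> ?F (u div m)" using J(2) by blast
    moreover have "u \<in> J \<inter> ?W (u div m)" "v \<in> J \<inter> ?W (u div m)" using uv by auto
    moreover have "u = v" if "S \<in> ?F b" "u \<in> S" "v \<in> S" for S b
      using that by auto
    ultimately show "u = v" by blast
  qed
  have "(\<Sum>J\<in>?T. lam ^ card J) =
      (\<Sum>J\<in>{I. I \<subseteq> (\<Union>b\<in>blocks x s. ?W b) \<and> (\<forall>b\<in>blocks x s. I \<inter> ?W b \<in> ?F b)}. lam ^ card J)"
    unfolding cell[symmetric] by (rule sum.cong) (use F inj in auto)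
  also have "\<dots> = (\<Prod>b\<in>blocks x s. \<Sum>J\<in>?F b. lam ^ card J)"
    by (rule sum_disjoint_families) (auto simp: finite_blocks finW disjoint_family_on_def)
  also have "\<dots> = (\<Prod>b\<in>blocks x s. 1 + real m * lam)"
  proof (rule prod.cong)
    fix b
    have "(\<Sum>J\<in>(\<lambda>v. {v}) ` ?W b. lam ^ card J) = (\<Sum>v\<in>?W b. lam)"
      by (subst sum.reindex) (auto simp: inj_on_def)
    moreover have "{} \<notin> (\<lambda>v. {v}) ` ?W b" by auto
    ultimately show "(\<Sum>J\<in>?F b. lam ^ card J) = 1 + real m * lam"
      using finW[of b] cardW[of b] by simp
  qed simp
  also have "\<dots> = (1 + real m * lam) ^ t" by (simp add: card_blocks)
  finally have all: "(\<Sum>J\<in>?T. lam ^ card J) = (1 + real m * lam) ^ t" .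
  have "finite (cell x s)" unfolding cell using finW finite_blocks by blast
  then have "finite ?T" by (auto intro: finite_subset[of _ "Pow (cell x s)"])
  moreover have "{} \<in> ?T" by simp
  ultimately have "(\<Sum>J\<in>?T. lam ^ card J) = 1 + (\<Sum>J\<in>?T - {{}}. lam ^ card J)"
    by (subst sum.remove[of _ "{}"]) auto
  moreover have "?T - {{}} = transversals (x, s)" by (auto simp: transversals_def)
  ultimately show ?thesis using all by (simp add: node_weight_def)
qed

lemma finite_cell: "finite (cell x s)"
proof -
  have "cell x s = (\<Union>b\<in>blocks x s. {v. v div m = b})"
    by (auto simp: cell_def div_m_in_blocks)
  then show ?thesis by (simp add: block_eq finite_blocks)
qed

lemma sum_cells:
  assumes "0 < lam" "finite C"
  shows "(\<Sum>I\<in>{I. I \<subseteq> (\<Union>c\<in>C. cell (fst c) (snd c)) \<and>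
      (\<forall>c\<in>C. I \<inter> cell (fst c) (snd c) \<in> transversals c)}. lam ^ card I) = node_weight lam ^ card C"
proof -
  have "(\<Sum>J\<in>transversals c. lam ^ card J) = node_weight lam" for c
    using sum_transversals[OF assms(1), of "fst c" "snd c"] by simp
  then show ?thesis
    using assms(2) by (subst sum_disjoint_families)
      (auto simp: disjoint_family_on_def finite_cell transversals_def, auto simp: cell_def)
qed

definition occ :: "nat set \<Rightarrow> bool \<Rightarrow> nat set" where
  "occ I s = node ` {v \<in> I. side v = s}"

lemma occ_iff: "x \<in> occ I s \<longleftrightarrow> I \<inter> cell x s \<noteq> {}"
  by (auto simp: occ_def cell_def)

lemma occ_separated:
  assumes "I \<in> independent_sets G"
  shows "(occ I d, occ I (\<not> d)) \<in> separated_pairs h"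
proof -
  have IV: "I \<subseteq> V" using assms by (simp add: independent_iff)
  have far: "\<not> heap_near x y" if xy: "x \<in> occ I s" "y \<in> occ I s'" "s \<noteq> s'" for x y s s'
  proof
    assume near: "heap_near x y"
    obtain u v where uv: "u \<in> I" "v \<in> I" "x = node u" "y = node v" "side u \<noteq> side v"
      using xy by (auto simp: occ_def)
    then have "adj u v" "u \<noteq> v" using near by (auto simp: adj_def)
    then show False using assms uv by (auto simp: independent_iff)
  qed
  have "occ I s \<subseteq> heap_nodes h" for s using IV by (auto simp: occ_def V_def)
  moreover have "x \<notin> occ I (\<not> d)" if "x \<in> occ I d" for x
    using far[OF that, of x "\<not> d"] by (auto simp: heap_near_def)
  moreover have "x div 2 \<notin> occ I (\<not> s)" if "x \<in> occ I s" for x s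
    using far[OF that, of "x div 2" "\<not> s"] by (auto simp: heap_near_def)
  from this[of _ d] this[of _ "\<not> d"]
  have "\<not> (x \<in> occ I d \<and> x div 2 \<in> occ I (\<not> d)) \<and> \<not> (x \<in> occ I (\<not> d) \<and> x div 2 \<in> occ I d)" for x
    by auto
  ultimately show ?thesis unfolding separated_pairs_def by auto
qed

text \<open>Forgetting the edges between different cells turns the sum into a product over the
  occupied cells; for an upper bound this is harmless.\<close>

lemma sum_occ_eq_le:
  assumes "0 < lam" "finite A" "finite B"
  shows "(\<Sum>I\<in>{I \<in> independent_sets G. (occ I d, occ I (\<not> d)) = (A, B)}. lam ^ card I) \<le>
    node_weight lam ^ (card A + card B)"
proof -
  let ?C = "A \<times> {d} \<union> B \<times> {\<not> d}"
  let ?fam = "{I. I \<subseteq> (\<Union>c\<in>?C. cell (fst c) (snd c)) \<and>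
      (\<forall>c\<in>?C. I \<inter> cell (fst c) (snd c) \<in> transversals c)}"
  have sub: "{I \<in> independent_sets G. (occ I d, occ I (\<not> d)) = (A, B)} \<subseteq> ?fam"
  proof
    fix I assume I: "I \<in> {I \<in> independent_sets G. (occ I d, occ I (\<not> d)) = (A, B)}"
    have C: "(x, s) \<in> ?C \<longleftrightarrow> x \<in> occ I s" for x s using I by (cases "s = d") auto
    have "v \<in> (\<Union>c\<in>?C. cell (fst c) (snd c))" if "v \<in> I" for v
    proof -
      have "v \<in> cell (node v) (side v)" by (simp add: cell_def)
      moreover from this have "(node v, side v) \<in> ?C" unfolding C occ_iff using that by blast
      ultimately show ?thesis by force
    qed
    moreover have "I \<inter> cell (fst c) (snd c) \<in> transversals c" if "c \<in> ?C" for c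
    proof -
      have "I \<inter> cell (fst c) (snd c) \<noteq> {}" using that C[of "fst c" "snd c"] by (simp add: occ_iff)
      moreover have "inj_on (\<lambda>v. v div m) (I \<inter> cell (fst c) (snd c))"
        using I independent_inj_on_block[of I] by (auto intro: inj_on_subset)
      ultimately show ?thesis by (simp add: transversals_def)
    qed
    ultimately show "I \<in> ?fam" by blast
  qed
  have fin: "finite ?C" using assms by simp
  have "finite ?fam"
    by (rule finite_subset[of _ "Pow (\<Union>c\<in>?C. cell (fst c) (snd c))"]) (use fin finite_cell in auto)
  then have "(\<Sum>I\<in>{I \<in> independent_sets G. (occ I d, occ I (\<not> d)) = (A, B)}. lam ^ card I) \<le>
      (\<Sum>I\<in>?fam. lam ^ card I)"
    using sub assms(1) by (intro sum_mono2) auto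
  also have "\<dots> = node_weight lam ^ card ?C" by (rule sum_cells[OF assms(1) fin])
  also have "card ?C = card A + card B"
    using assms by (subst card_Un_disjoint) (auto simp: card_cartesian_product)
  finally show ?thesis .
qed

text \<open>With all vertices on one side there are no edges between cells, so any choice of
  transversals at all nodes is independent. These states carry the mass against which the bottleneck
  is compared.\<close>

lemma sum_occ_full_ge:
  assumes "0 < lam"
  shows "node_weight lam ^ card (heap_nodes h) \<le>
    (\<Sum>I\<in>{I \<in> independent_sets G. occ I d = heap_nodes h}. lam ^ card I)"
proof -
  let ?C = "heap_nodes h \<times> {d}"
  let ?fam = "{I. I \<subseteq> (\<Union>c\<in>?C. cell (fst c) (snd c)) \<and>
      (\<forall>c\<in>?C. I \<inter> cell (fst c) (snd c) \<in> transversals c)}"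
  have sub: "?fam \<subseteq> {I \<in> independent_sets G. occ I d = heap_nodes h}"
  proof
    fix I assume I: "I \<in> ?fam"
    have cells: "node v \<in> heap_nodes h \<and> side v = d" if "v \<in> I" for v
      using I that by (auto simp: cell_def)
    have tr: "I \<inter> cell x d \<in> transversals (x, d)" if "x \<in> heap_nodes h" for x
      using I that by auto
    have "\<not> adj u v" if "u \<in> I" "v \<in> I" "u \<noteq> v" for u v
    proof
      assume "adj u v"
      then have eq: "u div m = v div m" using cells[OF that(1)] cells[OF that(2)] by (auto simp: adj_def)
      have "inj_on (\<lambda>v. v div m) (I \<inter> cell (node u) d)"
        using tr[of "node u"] cells[OF that(1)] by (simp add: transversals_def)
      moreover have "u \<in> I \<inter> cell (node u) d" "v \<in> I \<inter> cell (node u) d"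
        using that cells eq by (auto simp: cell_def node_def)
      ultimately show False using eq that(3) by (auto dest: inj_onD)
    qed
    then have "I \<in> independent_sets G"
      using cells by (auto simp: independent_iff V_def)
    moreover have "occ I d = heap_nodes h"
    proof (rule set_eqI)
      fix x show "x \<in> occ I d \<longleftrightarrow> x \<in> heap_nodes h"
        using tr[of x] cells by (auto simp: occ_def transversals_def cell_def)
    qed
    ultimately show "I \<in> {I \<in> independent_sets G. occ I d = heap_nodes h}" by simp
  qed
  have "node_weight lam ^ card (heap_nodes h) = node_weight lam ^ card ?C"
    by (simp add: card_cartesian_product)
  also have "\<dots> = (\<Sum>I\<in>?fam. lam ^ card I)"
    by (rule sum_cells[symmetric]) (use assms in auto)
  also have "\<dots> \<le> (\<Sum>I\<in>{I \<in> independent_sets G. occ I d = heap_nodes h}. lam ^ card I)"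
    using sub assms finite_independent_sets[of G] by (intro sum_mono2) (auto simp: verts_G finite_V)
  finally show ?thesis .
qed

lemma finite_verts_G: "finite (verts G)"
  by (simp add: verts_G finite_V)

lemma verts_G_nonempty: "verts G \<noteq> {}"
proof -
  have "node (m * (2 * t)) = 1" using m_pos t_pos by (simp add: node_def)
  then have "m * (2 * t) \<in> V" using one_in_heap_nodes by (simp add: V_def)
  then show ?thesis by (auto simp: verts_G)
qed

lemma prob_hardcore:
  assumes "0 < lam"
  shows "measure_pmf.prob (hardcore_pmf G lam) X =
    (\<Sum>I\<in>independent_sets G \<inter> X. lam ^ card I) / partition_function G lam"
proof -
  note fin = finite_verts_G
  have "measure_pmf.prob (hardcore_pmf G lam) X =
      measure_pmf.prob (hardcore_pmf G lam) (independent_sets G \<inter> X)"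
    by (rule measure_prob_cong_0) (auto simp: pmf_hardcore[OF fin assms])
  also have "\<dots> = (\<Sum>I\<in>independent_sets G \<inter> X. pmf (hardcore_pmf G lam) I)"
    by (rule measure_measure_pmf_finite) (simp add: finite_independent_sets[OF fin])
  also have "\<dots> = (\<Sum>I\<in>independent_sets G \<inter> X. lam ^ card I / partition_function G lam)"
    by (rule sum.cong) (auto simp: pmf_hardcore[OF fin assms])
  finally show ?thesis by (simp add: sum_divide_distrib)
qed

definition leaf_count :: "bool \<Rightarrow> nat set \<Rightarrow> nat" where
  "leaf_count d I = card (occ I d \<inter> heap_leaves h)"

text \<open>A step removes at most one vertex and so empties at most one node. Only decreases
  matter, because the set to be left has the form \<open>s \<le> leaf_count d I\<close>.\<close>

lemma leaf_count_step:
  assumes "0 < lam" "J \<in> set_pmf (glauber_step G lam I)"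
  shows "leaf_count d I \<le> Suc (leaf_count d J)"
proof -
  obtain v where "J \<in> set_pmf (glauber_site G lam v I)"
    using set_pmf_glauber_step[OF finite_verts_G verts_G_nonempty assms] by blast
  from set_pmf_glauber_site[OF assms(1) this]
  have "I - {v} \<subseteq> J" by auto
  then have "occ I d \<inter> heap_leaves h \<subseteq> insert (node v) (occ J d \<inter> heap_leaves h)"
    by (auto simp: occ_def)
  moreover have fin: "finite (occ J d \<inter> heap_leaves h)" by (simp add: heap_leaves_def)
  ultimately have "leaf_count d I \<le> card (insert (node v) (occ J d \<inter> heap_leaves h))"
    unfolding leaf_count_def by (intro card_mono) auto
  also have "\<dots> \<le> Suc (leaf_count d J)"
    unfolding leaf_count_def using card_insert_le_m1 by (simp add: card_insert_if fin)
  finally show ?thesis .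
qed

section \<open>The bottleneck\<close>

text \<open>The states are grouped by their pairs of occupied node sets. The leaf count
  \<open>s\<close> forces at least \<open>h / 18\<close> missing nodes for each of these pairs,
  hence at least \<open>j\<close>.\<close>

lemma sum_leaf_count_eq_le:
  assumes lam: "0 < lam" and s: "3 * s + 1 = 2 ^ (h + 1)" and j: "18 * j \<le> h"
    and L: "4 * 2 ^ (h + 1) \<le> node_weight lam"
  shows "(\<Sum>I\<in>independent_sets G \<inter> {I. leaf_count d I = s}. lam ^ card I) \<le>
    6 * node_weight lam ^ card (heap_nodes h) * (4 * 2 ^ (h + 1) / node_weight lam) ^ j"
proof -
  let ?X = "independent_sets G \<inter> {I. leaf_count d I = s}"
  let ?g = "\<lambda>I. (occ I d, occ I (\<not> d))"
  have fin: "finite ?X" using finite_independent_sets[OF finite_verts_G] by simp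
  have Q: "?g ` ?X \<subseteq> separated_pairs h" using occ_separated by auto
  have "(\<Sum>I\<in>?X. lam ^ card I) = (\<Sum>p\<in>?g ` ?X. \<Sum>I\<in>{I \<in> ?X. ?g I = p}. lam ^ card I)"
    by (rule sum.image_gen[OF fin])
  also have "\<dots> \<le> (\<Sum>p\<in>?g ` ?X. node_weight lam ^ (card (fst p) + card (snd p)))"
  proof (rule sum_mono)
    fix p assume p: "p \<in> ?g ` ?X"
    obtain A B where AB: "p = (A, B)" by (cases p)
    have "(A, B) \<in> separated_pairs h" using p Q AB by blast
    then have finAB: "finite A" "finite B"
      by (auto simp: separated_pairs_def intro: finite_subset[OF _ finite_heap_nodes])
    have "(\<Sum>I\<in>{I \<in> ?X. ?g I = p}. lam ^ card I) \<le>
        (\<Sum>I\<in>{I \<in> independent_sets G. ?g I = (A, B)}. lam ^ card I)"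
      using lam finite_independent_sets[OF finite_verts_G] AB by (intro sum_mono2) auto
    also have "\<dots> \<le> node_weight lam ^ (card A + card B)"
      by (rule sum_occ_eq_le[OF lam finAB])
    finally show "(\<Sum>I\<in>{I \<in> ?X. ?g I = p}. lam ^ card I) \<le> node_weight lam ^ (card (fst p) + card (snd p))"
      by (simp add: AB)
  qed
  also have "\<dots> = (\<Sum>(A, B)\<in>?g ` ?X. node_weight lam ^ (card A + card B))"
    by (rule sum.cong) (simp_all add: split_beta)
  also have "\<dots> \<le> 6 * node_weight lam ^ card (heap_nodes h) * (4 * 2 ^ (h + 1) / node_weight lam) ^ j"
  proof (rule sum_separated_pairs_le[OF Q _ L])
    fix A B assume "(A, B) \<in> ?g ` ?X"
    then obtain I where I: "I \<in> ?X" "(A, B) = ?g I" by blast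
    have AB: "(A, B) \<in> separated_pairs h" using I occ_separated by simp
    have "3 * card (A \<inter> heap_leaves h) + 1 = 2 ^ (h + 1)"
      using I s by (simp add: leaf_count_def)
    from separated_pairs_separator_ge[OF AB this] show "j \<le> card (heap_nodes h - A - B)"
      using j by linarith
  qed
  finally show ?thesis .
qed

text \<open>The bottleneck sets are given by at least s leaves being occupied on side d. More than half of
  the leaves are then on side d, so that the two bottleneck sets are disjoint and one of them has
  probability at most 1/2.\<close>

lemma mixing_time_ge:
  fixes s :: nat
  assumes lam: "0 < lam" and h: "2 \<le> h" and s: "3 * s + 1 = 2 ^ (h + 1)" and j: "18 * j \<le> h"
    and L: "4 * 2 ^ (h + 1) \<le> node_weight lam"
  shows "1 \<le> 24 * real (mixing_time G lam) * (4 * 2 ^ (h + 1) / node_weight lam) ^ j"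
proof -
  note G = finite_verts_G verts_G_nonempty lam
  let ?P = "measure_pmf.prob (hardcore_pmf G lam)"
  let ?Z = "partition_function G lam"
  let ?L = "node_weight lam"
  let ?N = "card (heap_nodes h)"
  define S where "S d = {I. s \<le> leaf_count d I}" for d
  have Z: "0 < ?Z" by (rule partition_function_pos[OF G(1) lam])
  have L0: "0 < ?L" using L by (rule less_le_trans[rotated]) simp
  have p4: "(4::nat) \<le> 2 ^ h" using power_increasing[OF h, of "2::nat"] by simp
  have card_leaves: "card (heap_leaves h) = 2 ^ h" by (simp add: heap_leaves_def)
  have "independent_sets G \<inter> (S True \<inter> S False) = {}"
  proof (rule ccontr)
    assume "independent_sets G \<inter> (S True \<inter> S False) \<noteq> {}"
    then obtain I where I: "I \<in> independent_sets G" "s \<le> leaf_count True I" "s \<le> leaf_count False I"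
      by (auto simp: S_def)
    have "occ I True \<inter> occ I False = {}"
      using occ_separated[OF I(1), of True] by (simp add: separated_pairs_def)
    then have "leaf_count True I + leaf_count False I =
        card (occ I True \<inter> heap_leaves h \<union> occ I False \<inter> heap_leaves h)"
      unfolding leaf_count_def by (subst card_Un_disjoint) (auto simp: heap_leaves_def)
    also have "\<dots> \<le> card (heap_leaves h)" by (intro card_mono) (auto simp: heap_leaves_def)
    \<comment> \<open>With \<open>3 * s + 1 = 2^(h + 1)\<close> this would give
      \<open>2^h \<le> 2\<close>, against \<open>2 \<le> h\<close>.\<close>
    finally have "2 * s \<le> 2 ^ h" using I card_leaves by simp
    then show False using s p4 by simp
  qed
  then have "?P (S True \<inter> S False) = 0" by (simp add: prob_hardcore[OF lam])
  moreover have "?P (S True \<union> S False) = ?P (S True) + (?P (S False) - ?P (S False \<inter> S True))"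
    by (simp add: measure_pmf.finite_measure_Union' measure_pmf.finite_measure_Diff')
  moreover have "?P (S True \<union> S False) \<le> 1" by simp
  ultimately have "?P (S True) \<le> 1 / 2 \<or> ?P (S False) \<le> 1 / 2"
    by (simp only: Int_commute[of "S False"]) linarith
  then obtain d where half: "?P (S d) \<le> 1 / 2" by blast
  let ?B = "{I. leaf_count d I = s}"
  have "?P (S d) \<le> 4 * real (mixing_time G lam) * ?P ?B"
  proof (rule bottleneck_mixing_time[OF G _ half])
    fix I J assume "I \<in> S d" "I \<notin> ?B" "J \<in> set_pmf (glauber_step G lam I)"
    then show "J \<in> S d"
      using leaf_count_step[OF lam, of J I d] by (simp add: S_def)
  qed
  moreover have "?L ^ ?N / ?Z \<le> ?P (S d)"
  proof -
    have "?L ^ ?N \<le> (\<Sum>I\<in>{I \<in> independent_sets G. occ I d = heap_nodes h}. lam ^ card I)"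
      by (rule sum_occ_full_ge[OF lam])
    also have "\<dots> \<le> (\<Sum>I\<in>independent_sets G \<inter> S d. lam ^ card I)"
    proof (rule sum_mono2)
      show "finite (independent_sets G \<inter> S d)" using finite_independent_sets[OF G(1)] by simp
      have "heap_nodes h \<inter> heap_leaves h = heap_leaves h"
        by (auto simp: heap_nodes_def heap_leaves_def Suc_le_eq intro: less_le_trans[rotated])
      moreover have "s \<le> 2 ^ h" using s p4 by simp
      ultimately show "{I \<in> independent_sets G. occ I d = heap_nodes h} \<subseteq> independent_sets G \<inter> S d"
        by (auto simp: S_def leaf_count_def card_leaves)
    qed (use lam in auto)
    finally show ?thesis unfolding prob_hardcore[OF lam] using Z by (simp add: divide_right_mono)
  qed
  moreover have "?P ?B \<le> 6 * ?L ^ ?N * (4 * 2 ^ (h + 1) / ?L) ^ j / ?Z"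
    unfolding prob_hardcore[OF lam] using Z
    by (intro divide_right_mono sum_leaf_count_eq_le[OF lam s j L]) simp
  then have "4 * real (mixing_time G lam) * ?P ?B \<le>
      4 * real (mixing_time G lam) * (6 * ?L ^ ?N * (4 * 2 ^ (h + 1) / ?L) ^ j / ?Z)"
    by (rule mult_left_mono) simp
  ultimately have "?L ^ ?N / ?Z \<le> 4 * real (mixing_time G lam) * (6 * ?L ^ ?N * (4 * 2 ^ (h + 1) / ?L) ^ j / ?Z)"
    by (meson order.trans)
  \<comment> \<open>The weight of the states fully on side \<open>d\<close> appears on both sides
    and cancels, the partition function with it; 24 is the 4 of the bottleneck bound times the 6 of
    the weight bound.\<close>
  also have "\<dots> = 24 * real (mixing_time G lam) * (4 * 2 ^ (h + 1) / ?L) ^ j * (?L ^ ?N / ?Z)"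
    by simp
  finally have "1 * (?L ^ ?N / ?Z) \<le> 24 * real (mixing_time G lam) * (4 * 2 ^ (h + 1) / ?L) ^ j * (?L ^ ?N / ?Z)"
    by simp
  then show ?thesis using L0 Z by (simp only: mult_le_cancel_right_pos zero_less_divide_iff zero_less_power simp_thms)
qed

end

section \<open>Choice of the parameters\<close>

lemma digraph_iso_card_verts: "digraph_iso G H \<Longrightarrow> card (verts G) = card (verts H)"
  unfolding digraph_iso_def by (auto simp: pre_digraph.digraph_isomorphism_def card_image)

text \<open>With \<open>x = m * lam\<close> this absorbs the \<open>- 1\<close> in
  \<open>node_weight\<close>, which is therefore at least \<open>(m * lam)^t\<close>.\<close>

lemma one_plus_power_le:
  fixes x :: real
  assumes "0 \<le> x" "1 \<le> t"
  shows "1 + x ^ t \<le> (1 + x) ^ t"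
  using assms(2)
proof (induction rule: dec_induct)
  case (step t)
  have "1 + x ^ Suc t \<le> (1 + x) * (1 + x ^ t)" using assms(1) by (simp add: algebra_simps)
  also have "\<dots> \<le> (1 + x) * (1 + x) ^ t" using step assms(1) by (intro mult_left_mono) auto
  finally show ?case by simp
qed simp

lemma ex_third_of_power_4: "\<exists>s::nat. 3 * s + 1 = 4 ^ k"
proof (induction k)
  case (Suc k)
  then obtain s :: nat where "3 * s + 1 = 4 ^ k" by blast
  then have "3 * (4 * s + 1) + 1 = 4 ^ Suc k" by simp
  then show ?case by blast
qed simp

text \<open>The four factors in \<open>M^4\<close> have different tasks. Two of them, raised to the
  power \<open>t\<close>, outweigh the entropy \<open>4 * M\<close>; one, raised to
  \<open>2 * p\<close>, outweighs 24; the last joins \<open>lam\<close>, as \<open>lam * n\<close>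
  is at most \<open>(M * lam)^6\<close>. Moreover \<open>ln n\<close> is at most
  \<open>6 * (36 * p + 2)\<close>, hence at most \<open>228 * p\<close>, and
  \<open>1368 = 6 * 228\<close> keeps six times the exponent below \<open>t * p\<close>.\<close>

lemma quasipolynomial_le:
  fixes lam L T :: real and n p t :: nat
  defines "M \<equiv> 2 ^ (36 * p + 2) :: real"
  assumes p: "1 \<le> p" and t: "1 \<le> t" and lam: "1 \<le> lam" and n: "1 \<le> n" "real n \<le> M ^ 6"
    and L: "(M ^ 4 * lam) ^ t \<le> L" and T: "1 \<le> 24 * T * (4 * M / L) ^ (2 * p)"
  shows "(lam * real n) powr (1 / 1368 * real t * ln (real n)) \<le> T"
proof -
  have "(2::real) ^ 5 \<le> M" unfolding M_def using p by (intro power_increasing) auto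
  then have M: "24 \<le> M" by simp
  have Ml: "1 \<le> M * lam" using M lam mult_mono[of 1 M 1 lam] by simp
  let ?e = "1 / 1368 * real t * ln (real n)"
  have "ln (real n) \<le> ln (M ^ 6)" using n M by (subst ln_le_cancel_iff) auto
  also have "\<dots> = 6 * ln M" using M by (simp add: ln_realpow)
  also have "ln M = real (36 * p + 2) * ln 2" unfolding M_def by (rule ln_realpow)
  finally have "ln (real n) \<le> 6 * (real (36 * p + 2) * ln 2)" .
  also have "\<dots> \<le> 6 * (real (36 * p + 2) * 1)"
    using ln_2_less_1 by (intro mult_left_mono) auto
  also have "\<dots> \<le> 228 * real p" using p by simp
  finally have "ln (real n) \<le> 228 * real p" .
  then have "real t * ln (real n) \<le> real t * (228 * real p)" by (intro mult_left_mono) auto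
  then have e: "6 * ?e \<le> real (t * p)" by simp
  have e0: "0 \<le> ?e" using n by simp
  have "lam * real n \<le> lam * M ^ 6" using n lam by (intro mult_left_mono) auto
  also have "\<dots> \<le> lam ^ 6 * M ^ 6"
    using self_le_power[of lam 6] lam M by (intro mult_right_mono) auto
  also have "\<dots> = (M * lam) powr 6" using Ml by (simp add: power_mult_distrib mult.commute)
  finally have "(lam * real n) powr ?e \<le> ((M * lam) powr 6) powr ?e"
    using e0 lam n by (intro powr_mono2) auto
  also have "\<dots> = (M * lam) powr (6 * ?e)" by (rule powr_powr)
  also have "\<dots> \<le> (M * lam) powr real (t * p)" using e Ml by (rule powr_mono)
  also have "\<dots> = (M * lam) ^ (t * p)" using Ml by (intro powr_realpow) simp
  finally have 1: "(lam * real n) powr ?e \<le> (M * lam) ^ (t * p)" .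

  define y where "y = L / (4 * M)"
  have "0 < (M ^ 4 * lam) ^ t" using M lam by simp
  then have L0: "0 < L" using L by linarith
  have "4 * M \<le> M * M" using M by (intro mult_right_mono) auto
  also have "\<dots> \<le> (M * M) ^ t" using t M mult_mono[of 1 M 1 M] by (intro self_le_power) auto
  finally have a: "4 * M \<le> (M * M) ^ t" .
  have b: "M \<le> M ^ t" using t M by (intro self_le_power) auto
  have "4 * M * (M * (M * lam) ^ t) \<le> (M * M) ^ t * (M ^ t * (M * lam) ^ t)"
    using a b M lam by (intro mult_mono) auto
  also have "\<dots> = (M ^ 4 * lam) ^ t"
  proof -
    have "(M * M) ^ t * (M ^ t * (M * lam) ^ t) = ((M * M) * (M * (M * lam))) ^ t"
      by (simp only: power_mult_distrib)
    also have "(M * M) * (M * (M * lam)) = M ^ 4 * lam" by (simp add: power4_eq_xxxx)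
    finally show ?thesis .
  qed
  also note L
  finally have y: "M * (M * lam) ^ t \<le> y"
    using M by (simp add: y_def field_simps)
  have "24 * (M * lam) ^ (t * p) \<le> M ^ (2 * p) * (M * lam) ^ (t * (2 * p))"
  proof (rule mult_mono)
    show "24 \<le> M ^ (2 * p)" using M p self_le_power[of M "2 * p"] by simp
    show "(M * lam) ^ (t * p) \<le> (M * lam) ^ (t * (2 * p))" using Ml by (intro power_increasing) auto
  qed (use M Ml in auto)
  also have "\<dots> = (M * (M * lam) ^ t) ^ (2 * p)" by (simp add: power_mult_distrib power_mult)
  also have "\<dots> \<le> y ^ (2 * p)" using y M lam by (intro power_mono) auto
  also have "\<dots> \<le> 24 * T * (4 * M / L) ^ (2 * p) * y ^ (2 * p)"
    using mult_right_mono[OF T, of "y ^ (2 * p)"] L0 M by (simp add: y_def)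
  also have "(4 * M / L) ^ (2 * p) * y ^ (2 * p) = 1"
    using L0 M by (simp add: y_def flip: power_mult_distrib)
  then have "24 * T * (4 * M / L) ^ (2 * p) * y ^ (2 * p) = 24 * T"
    by (simp only: mult.assoc mult_1_right)
  finally show ?thesis using 1 by linarith
qed

text \<open>The height \<open>h = 36 * p + 1\<close> is odd, so that 3 divides
  \<open>2^(h + 1) - 1\<close>, and it guarantees \<open>j = 2 * p\<close> missing nodes. The
  cliques have size \<open>M^4\<close> for \<open>M = 2^(h + 1)\<close>. Taking \<open>p\<close> at
  least \<open>t\<close> gives \<open>2 * t \<le> M\<close>, so that the order is at most
  \<open>M^6\<close> and the constant in the exponent does not depend on \<open>t\<close>.\<close>

lemma clique_blowup_mixing_time_ge:
  fixes lam :: real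
  assumes p: "t \<le> p" and t: "1 \<le> t" and lam: "1 \<le> lam"
  defines "H \<equiv> clique_blowup.G t ((2 ^ (36 * p + 2)) ^ 4) (36 * p + 1)"
  shows "(lam * real (card (verts H))) powr (1 / 1368 * real t * ln (real (card (verts H))))
    \<le> real (mixing_time H lam)"
proof -
  let ?M = "2 ^ (36 * p + 2) :: real"
  let ?Mn = "2 ^ (36 * p + 2) :: nat"
  interpret clique_blowup t "?Mn ^ 4" "36 * p + 1"
    by unfold_locales (use t in auto)
  have M4: "4 \<le> ?M" using power_increasing[of 2 "36 * p + 2" "2::real"] by simp
  obtain s :: nat where "3 * s + 1 = 4 ^ (18 * p + 1)" using ex_third_of_power_4 by blast
  also have "(4::nat) ^ (18 * p + 1) = 2 ^ (2 * (18 * p + 1))" by (simp add: power_mult)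
  finally have s: "3 * s + 1 = 2 ^ (36 * p + 1 + 1)" by (simp add: algebra_simps)
  have "1 + (?M ^ 4 * lam) ^ t \<le> (1 + ?M ^ 4 * lam) ^ t"
    by (rule one_plus_power_le) (use lam t in auto)
  then have L: "(?M ^ 4 * lam) ^ t \<le> node_weight lam"
    unfolding node_weight_def of_nat_power of_nat_numeral by linarith
  have "1 \<le> ?M ^ 4" by (intro one_le_power) simp
  then have "1 * 1 \<le> ?M ^ 4 * lam" using lam by (intro mult_mono) auto
  then have "1 \<le> ?M ^ 4 * lam" by (simp only: mult_1_left)
  then have m1: "?M ^ 4 * lam \<le> (?M ^ 4 * lam) ^ t" using t by (intro self_le_power) auto
  have "?M ^ 4 * 1 \<le> ?M ^ 4 * lam" using lam by (intro mult_left_mono) auto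
  then have m2: "?M ^ 4 \<le> ?M ^ 4 * lam" by (simp only: mult_1_right)
  have "4 * ?M \<le> ?M * ?M" using M4 by (intro mult_right_mono) auto
  also have "\<dots> = ?M ^ 2" by (simp only: power2_eq_square)
  also have "\<dots> \<le> ?M ^ 4" by (intro power_increasing one_le_power) auto
  also note m2
  also note m1
  also note L
  finally have nw: "4 * 2 ^ (36 * p + 1 + 1) \<le> node_weight lam"
    by (simp only: add.assoc one_add_one)
  have T: "1 \<le> 24 * real (mixing_time G lam) * (4 * 2 ^ (36 * p + 1 + 1) / node_weight lam) ^ (2 * p)"
    by (rule mixing_time_ge[OF _ _ s _ nw]) (use lam t p in auto)
  have card: "card (verts G) = (?Mn - 1) * (?Mn ^ 4 * (2 * t))"
    unfolding verts_G card_V by simp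
  have "2 * t \<le> ?Mn"
  proof -
    have "t < 2 ^ t" by simp
    then have "2 * t \<le> 2 ^ (t + 1)" by simp
    also have "\<dots> \<le> ?Mn" using p by (intro power_increasing) auto
    finally show ?thesis .
  qed
  then have "card (verts G) \<le> ?Mn * (?Mn ^ 4 * ?Mn)"
    unfolding card by (intro mult_mono) auto
  then have "real (card (verts G)) \<le> real (?Mn * (?Mn ^ 4 * ?Mn))" by (rule of_nat_mono)
  also have "\<dots> = ?M ^ 6" by (simp only: of_nat_mult of_nat_power of_nat_numeral) (simp flip: power_Suc power_Suc2)
  finally have n6: "real (card (verts G)) \<le> ?M ^ 6" .
  have n1: "1 \<le> card (verts G)"
    using finite_verts_G verts_G_nonempty by (simp add: Suc_le_eq card_gt_0_iff)
  show ?thesis unfolding H_def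
    by (rule quasipolynomial_le[OF _ t lam n1 n6 L]) (use T t p in \<open>simp_all add: numeral_2_eq_2\<close>)
qed

theorem theorem4:
  shows "\<exists>c::real. 0 < c \<and>
    (\<forall>t::nat. 1 \<le> t \<longrightarrow>
      (\<exists>\<G> :: (nat, nat \<times> nat) pre_digraph set.
        infinite \<G> \<and>
        (\<forall>G\<in>\<G>. \<forall>H\<in>\<G>. digraph_iso G H \<longrightarrow> G = H) \<and>
        (\<forall>G\<in>\<G>. graph G \<and> tree_alpha G = 2 * t \<and>
          (\<forall>lam::real. 1 \<le> lam \<longrightarrow>
            real (mixing_time G lam) \<ge>
              (lam * real (card (verts G))) powr (c * real t * ln (real (card (verts G))))))))"
proof (intro exI[of _ "1 / 1368"] conjI allI impI)
  fix t :: nat assume t: "1 \<le> t"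
  let ?H = "\<lambda>p. clique_blowup.G t ((2 ^ (36 * p + 2)) ^ 4) (36 * p + 1)"
  let ?\<G> = "?H ` {t..}"
  have blowup: "clique_blowup t ((2 ^ (36 * p + 2)) ^ 4) (36 * p + 1)" for p
    by unfold_locales (use t in auto)
  have card: "card (verts (?H p)) = (2 ^ (36 * p + 2) - 1) * ((2 ^ (36 * p + 2)) ^ 4 * (2 * t))" for p
    using clique_blowup.verts_G[OF blowup] clique_blowup.card_V[OF blowup] by simp
  \<comment> \<open>The order grows strictly with \<open>p\<close>, so different parameters give
    non-isomorphic graphs and the family is infinite up to isomorphism.\<close>
  have "card (verts (?H p)) < card (verts (?H q))" if "p < q" for p q
  proof -
    have less: "(2::nat) ^ (36 * p + 2) < 2 ^ (36 * q + 2)" using that by (intro power_strict_increasing) auto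
    then have "(2::nat) ^ (36 * p + 2) - 1 < 2 ^ (36 * q + 2) - 1" by (intro diff_less_mono) auto
    moreover have "((2::nat) ^ (36 * p + 2)) ^ 4 * (2 * t) \<le> (2 ^ (36 * q + 2)) ^ 4 * (2 * t)"
      using less by (intro mult_right_mono power_mono) auto
    ultimately show ?thesis unfolding card using t by (intro mult_less_le_imp_less) auto
  qed
  then have eq: "p = q" if "card (verts (?H p)) = card (verts (?H q))" for p q
    using that by (metis less_irrefl linorder_neqE_nat)
  have "inj_on ?H {t..}" using eq by (intro inj_onI) metis
  then have "infinite ?\<G>" by (simp add: finite_image_iff infinite_Ici)
  moreover have "\<forall>G\<in>?\<G>. \<forall>H\<in>?\<G>. digraph_iso G H \<longrightarrow> G = H"
    using eq digraph_iso_card_verts by (metis (no_types, lifting) imageE)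
  moreover have "\<forall>G\<in>?\<G>. graph G \<and> tree_alpha G = 2 * t \<and> (\<forall>lam::real. 1 \<le> lam \<longrightarrow>
      real (mixing_time G lam) \<ge> (lam * real (card (verts G))) powr (1 / 1368 * real t * ln (real (card (verts G)))))"
    using clique_blowup.graph_G[OF blowup] clique_blowup.tree_alpha_G[OF blowup]
      clique_blowup_mixing_time_ge t by auto
  ultimately show "\<exists>\<G> :: (nat, nat \<times> nat) pre_digraph set. infinite \<G> \<and>
      (\<forall>G\<in>\<G>. \<forall>H\<in>\<G>. digraph_iso G H \<longrightarrow> G = H) \<and>
      (\<forall>G\<in>\<G>. graph G \<and> tree_alpha G = 2 * t \<and> (\<forall>lam::real. 1 \<le> lam \<longrightarrow>
        real (mixing_time G lam) \<ge> (lam * real (card (verts G))) powr (1 / 1368 * real t * ln (real (card (verts G))))))"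
    by (intro exI[of _ ?\<G>] conjI)
qed simp

end
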